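(* For every $n>2$ there exists a vertex-faithful simplicial sphere $X_{C_n}$ whose face graph is (isomorphic to) $\Gamma_{C_n}$ and whose automorphism group is isomorphic to the cyclic group $C_n$ of order $n$. Furthermore, the graph $\Gamma_{C_n}$ is a $3$-connected planar cubic graph.
   Context: The graph $\Gamma_{C_n}$ has the $6n$ nodes $a_i,b_i,c_i,d_i,e_i,f_i$ ($i=1,\dots,n$) and the edges $\{a_i,b_i\}$, $\{a_i,e_i\}$, $\{a_i,f_i\}$, $\{b_i,f_i\}$, $\{c_i,d_i\}$, $\{c_i,f_i\}$, $\{c_i,e_i\}$ for $i=1,\dots,n$, together with $\{b_{j+1},e_j\}$ and $\{d_j,d_{j+1}\}$ for $j=1,\dots,n-1$, and $\{b_1,e_n\}$ and $\{d_1,d_n\}$. A (closed) simplicial surface $(X,<)$ is a countable set $X$ partitioned into non-empty sets $X_0$ (vertices), $X_1$ (edges), $X_2$ (faces), together with a relation $<$ (incidence), a subset of $(X_0\times X_1)\cup(X_1\times X_2)\cup(X_0\times X_2)$, such that: (1) for each edge $e\in X_1$ there are exactly two vertices $V\in X_0$ with $V<e$; (2) for each face $F\in X_2$ there are exactly three edges $e\in X_1$ with $e<F$ and exactly three vertices $V\in X_0$ with $V<F$, and each of these three vertices is incident to exactly two of these three edges; (3) for each edge $e\in X_1$ there are exactly two faces $F\in X_2$ with $e<F$; (4) (umbrella condition) for each vertex $V\in X_0$ the number $m=\deg(V)$ of faces $F\in X_2$ with $V<F$ satisfies $3\le \deg(V)<\infty$, and these faces can be arranged in a sequence $(F_1,\dots,F_m)$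 such that, with $F_{m+1}=F_1$, the faces $F_i$ and $F_{i+1}$ share a common edge $e_i$ with $V<e_i$ for $i=1,\dots,m$. A homomorphism $\pi:X\to Y$ of simplicial surfaces is a map such that $A<_X B$ implies $\pi(A)<_Y\pi(B)$, and such that for every face $F$ the restriction of $\pi$ to the vertices and edges incident to $F$ is an isomorphism onto the set of vertices and edges incident to $\pi(F)$. $\mathrm{Aut}(X)$ is the group of automorphisms of $X$, i.e. invertible homomorphisms $X\to X$ (equivalently, permutations of $X$ preserving each of $X_0,X_1,X_2$ and preserving the incidence relation in both directions). $X$ is vertex-faithful if the map $X\to\mathcal{P}(X_0)$, $x\mapsto\{V\in X_0\mid V<x\text{ or }V=x\}$, is injective. A simplicial sphere is a connected finite simplicial surface with Euler characteristic $\chi(X)=|X_0|-|X_1|+|X_2|=2$. The face graph $\mathcal{F}(X)$ has node set $X_2$ and edge set $X_1$, where $e\in X_1$ connects the two faces $F$ with $e<F$. *)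

theory Defs
  imports "HOL-Analysis.Analysis" "HOL-Algebra.Bij" "HOL-Algebra.Elementary_Groups"
begin

text \<open>
  The face graph of a simplicial surface has the edges of the surface as its edges, so two nodes
  may be joined by several edges. Graphs therefore carry an abstract edge set together with a
  function assigning to each edge its set of end nodes; a simple graph is one whose edges are
  two-element sets of nodes, with the identity as \<open>ends\<close>.
\<close>

record ('v, 'e) mgraph =
  nodes :: "'v set"
  links :: "'e set"
  ends :: "'e \<Rightarrow> 'v set"

definition mgraph :: "('v, 'e) mgraph \<Rightarrow> bool" where
  "mgraph G \<longleftrightarrow> (\<forall>e \<in> links G. ends G e \<subseteq> nodes G \<and> card (ends G e) = 2)"

definition graph_iso :: "('v, 'e) mgraph \<Rightarrow> ('w, 'f) mgraph \<Rightarrow> bool" where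
  "graph_iso G H \<longleftrightarrow>
     (\<exists>\<phi> \<psi>. bij_betw \<phi> (nodes G) (nodes H) \<and> bij_betw \<psi> (links G) (links H) \<and>
        (\<forall>e \<in> links G. ends H (\<psi> e) = \<phi> ` ends G e))"

definition adjacent :: "('v, 'e) mgraph \<Rightarrow> ('v \<times> 'v) set" where
  "adjacent G = {(u, v). \<exists>e \<in> links G. ends G e = {u, v}}"

definition connected_graph :: "('v, 'e) mgraph \<Rightarrow> bool" where
  "connected_graph G \<longleftrightarrow>
     nodes G \<noteq> {} \<and> (\<forall>u \<in> nodes G. \<forall>v \<in> nodes G. (u, v) \<in> (adjacent G)\<^sup>*)"

definition delete_nodes :: "('v, 'e) mgraph \<Rightarrow> 'v set \<Rightarrow> ('v, 'e) mgraph" where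
  "delete_nodes G S =
     \<lparr>nodes = nodes G - S, links = {e \<in> links G. ends G e \<inter> S = {}}, ends = ends G\<rparr>"

definition k_connected :: "nat \<Rightarrow> ('v, 'e) mgraph \<Rightarrow> bool" where
  "k_connected k G \<longleftrightarrow>
     finite (nodes G) \<and> k < card (nodes G) \<and>
     (\<forall>S \<subseteq> nodes G. card S < k \<longrightarrow> connected_graph (delete_nodes G S))"

definition cubic :: "('v, 'e) mgraph \<Rightarrow> bool" where
  "cubic G \<longleftrightarrow> (\<forall>v \<in> nodes G. card {e \<in> links G. v \<in> ends G e} = 3)"

text \<open>
  A graph is planar if it can be drawn in the plane, here \<^typ>\<open>complex\<close>: nodes become
  distinct points, edges become arcs joining their end nodes, an arc meets nodes only in its own
  ends, and two different arcs meet only in common ends.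
\<close>

definition planar :: "('v, 'e) mgraph \<Rightarrow> bool" where
  "planar G \<longleftrightarrow>
     (\<exists>(p :: 'v \<Rightarrow> complex) (\<gamma> :: 'e \<Rightarrow> real \<Rightarrow> complex).
        inj_on p (nodes G) \<and>
        (\<forall>e \<in> links G. arc (\<gamma> e) \<and> {pathstart (\<gamma> e), pathfinish (\<gamma> e)} = p ` ends G e \<and>
           path_image (\<gamma> e) \<inter> p ` nodes G = p ` ends G e) \<and>
        (\<forall>e \<in> links G. \<forall>e' \<in> links G. e \<noteq> e' \<longrightarrow>
           path_image (\<gamma> e) \<inter> path_image (\<gamma> e') \<subseteq> p ` (ends G e \<inter> ends G e')))"

record 'a surface =
  verts :: "'a set"
  edges :: "'a set"
  faces :: "'a set"
  inc :: "'a \<Rightarrow> 'a \<Rightarrow> bool" (infix "\<triangleleft>\<index>" 50)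

definition points :: "'a surface \<Rightarrow> 'a set" where
  "points X = verts X \<union> edges X \<union> faces X"

text \<open>
  In the umbrella condition the sequence of faces around a vertex is a list, indexed from \<open>0\<close>
  and read cyclically.
\<close>

definition umbrella :: "'a surface \<Rightarrow> 'a \<Rightarrow> 'a list \<Rightarrow> bool" where
  "umbrella X V Fs \<longleftrightarrow>
     distinct Fs \<and> set Fs = {F \<in> faces X. V \<triangleleft>\<^bsub>X\<^esub> F} \<and>
     (\<forall>i < length Fs. \<exists>e \<in> edges X.
        V \<triangleleft>\<^bsub>X\<^esub> e \<and> e \<triangleleft>\<^bsub>X\<^esub> Fs ! i \<and> e \<triangleleft>\<^bsub>X\<^esub> Fs ! (Suc i mod length Fs))"

locale simplicial_surface =
  fixes X :: "'a surface" (structure)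
  assumes countable_points: "countable (points X)"
    and verts_nonempty: "verts X \<noteq> {}"
    and edges_nonempty: "edges X \<noteq> {}"
    and faces_nonempty: "faces X \<noteq> {}"
    and verts_edges_disjoint: "verts X \<inter> edges X = {}"
    and verts_faces_disjoint: "verts X \<inter> faces X = {}"
    and edges_faces_disjoint: "edges X \<inter> faces X = {}"
    and inc_subset: "{(A, B). A \<triangleleft> B} \<subseteq>
      verts X \<times> edges X \<union> edges X \<times> faces X \<union> verts X \<times> faces X"
    and edge_verts: "e \<in> edges X \<Longrightarrow> card {V \<in> verts X. V \<triangleleft> e} = 2"
    and face_edges: "F \<in> faces X \<Longrightarrow> card {e \<in> edges X. e \<triangleleft> F} = 3"
    and face_verts: "F \<in> faces X \<Longrightarrow> card {V \<in> verts X. V \<triangleleft> F} = 3"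
    and face_vert_edges: "\<lbrakk>F \<in> faces X; V \<in> verts X; V \<triangleleft> F\<rbrakk> \<Longrightarrow>
      card {e \<in> edges X. e \<triangleleft> F \<and> V \<triangleleft> e} = 2"
    and edge_faces: "e \<in> edges X \<Longrightarrow> card {F \<in> faces X. e \<triangleleft> F} = 2"
    and vert_degree: "V \<in> verts X \<Longrightarrow>
      finite {F \<in> faces X. V \<triangleleft> F} \<and> 3 \<le> card {F \<in> faces X. V \<triangleleft> F}"
    and vert_umbrella: "V \<in> verts X \<Longrightarrow> \<exists>Fs. umbrella X V Fs"

definition vertex_faithful :: "'a surface \<Rightarrow> bool" where
  "vertex_faithful X \<longleftrightarrow> inj_on (\<lambda>x. {V \<in> verts X. V \<triangleleft>\<^bsub>X\<^esub> x \<or> V = x}) (points X)"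

text \<open>
  Connectedness is taken through arbitrary incidences. By the umbrella condition this agrees with
  connectedness of the face graph.
\<close>

definition connected_surface :: "'a surface \<Rightarrow> bool" where
  "connected_surface X \<longleftrightarrow>
     (\<forall>A \<in> points X. \<forall>B \<in> points X. (A, B) \<in> {(C, D). C \<triangleleft>\<^bsub>X\<^esub> D \<or> D \<triangleleft>\<^bsub>X\<^esub> C}\<^sup>*)"

definition euler_char :: "'a surface \<Rightarrow> int" where
  "euler_char X = int (card (verts X)) - int (card (edges X)) + int (card (faces X))"

definition simplicial_sphere :: "'a surface \<Rightarrow> bool" where
  "simplicial_sphere X \<longleftrightarrow>
     simplicial_surface X \<and> finite (points X) \<and> connected_surface X \<and> euler_char X = 2"

definition face_graph :: "'a surface \<Rightarrow> ('a, 'a) mgraph" where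
  "face_graph X =
     \<lparr>nodes = faces X, links = edges X, ends = (\<lambda>e. {F \<in> faces X. e \<triangleleft>\<^bsub>X\<^esub> F})\<rparr>"

lemma mgraph_face_graph: "simplicial_surface X \<Longrightarrow> mgraph (face_graph X)"
  by (auto simp: mgraph_def face_graph_def simplicial_surface.edge_faces)

definition face_boundary :: "'a surface \<Rightarrow> 'a \<Rightarrow> 'a set" where
  "face_boundary X F = {A \<in> verts X \<union> edges X. A \<triangleleft>\<^bsub>X\<^esub> F}"

definition surface_hom :: "'a surface \<Rightarrow> 'b surface \<Rightarrow> ('a \<Rightarrow> 'b) set" where
  "surface_hom X Y = {\<pi>.
     \<pi> \<in> points X \<rightarrow> points Y \<and>
     (\<forall>A \<in> points X. \<forall>B \<in> points X. A \<triangleleft>\<^bsub>X\<^esub> B \<longrightarrow> \<pi> A \<triangleleft>\<^bsub>Y\<^esub> \<pi> B) \<and>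
     (\<forall>F \<in> faces X.
        bij_betw \<pi> (face_boundary X F) (face_boundary Y (\<pi> F)) \<and>
        (\<forall>A \<in> face_boundary X F. \<forall>B \<in> face_boundary X F.
           A \<triangleleft>\<^bsub>X\<^esub> B \<longleftrightarrow> \<pi> A \<triangleleft>\<^bsub>Y\<^esub> \<pi> B))}"

text \<open>
  As for \<^const>\<open>AutoGroup\<close>, automorphisms are extensional functions, so that each automorphism is
  represented by exactly one function of the ambient type.
\<close>

definition surface_auts :: "'a surface \<Rightarrow> ('a \<Rightarrow> 'a) set" where
  "surface_auts X = {\<pi> \<in> Bij (points X).
     \<pi> \<in> surface_hom X X \<and> inv_into (points X) \<pi> \<in> surface_hom X X}"

definition aut_group :: "'a surface \<Rightarrow> ('a \<Rightarrow> 'a) monoid" where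
  "aut_group X = BijGroup (points X) \<lparr>carrier := surface_auts X\<rparr>"

lemma surface_hom_cong:
  assumes "f \<in> surface_hom X Y" "\<And>x. x \<in> points X \<Longrightarrow> f x = g x"
  shows "g \<in> surface_hom X Y"
proof -
  have sub: "face_boundary X F \<subseteq> points X" for F
    by (auto simp: face_boundary_def points_def)
  have "bij_betw g (face_boundary X F) (face_boundary Y (g F))"
    if "F \<in> faces X" for F
  proof -
    have "bij_betw f (face_boundary X F) (face_boundary Y (f F))" and "F \<in> points X"
      using assms(1) that by (auto simp: surface_hom_def points_def)
    moreover have "bij_betw f (face_boundary X F) T = bij_betw g (face_boundary X F) T" for T
      using sub assms(2) by (intro bij_betw_cong) blast
    ultimately show ?thesis using assms(2) by simp
  qed
  moreover have eq: "g x = f x" if "x \<in> points X" for x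
    using that assms(2) by simp
  moreover have "g \<in> points X \<rightarrow> points Y"
    using assms(1) eq by (auto simp: surface_hom_def Pi_iff)
  moreover have "\<forall>A \<in> points X. \<forall>B \<in> points X. A \<triangleleft>\<^bsub>X\<^esub> B \<longrightarrow> g A \<triangleleft>\<^bsub>Y\<^esub> g B"
    using assms(1) eq by (auto simp: surface_hom_def)
  moreover have "A \<triangleleft>\<^bsub>X\<^esub> B \<longleftrightarrow> g A \<triangleleft>\<^bsub>Y\<^esub> g B"
    if "F \<in> faces X" "A \<in> face_boundary X F" "B \<in> face_boundary X F" for F A B
  proof -
    have "A \<in> points X" "B \<in> points X" using sub that by auto
    then show ?thesis using assms(1) eq that by (auto simp: surface_hom_def)
  qed
  ultimately show ?thesis by (simp add: surface_hom_def)
qed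

lemma surface_hom_comp:
  assumes f: "f \<in> surface_hom X Y" and g: "g \<in> surface_hom Y Z"
    and faces: "\<And>F. F \<in> faces X \<Longrightarrow> f F \<in> faces Y"
  shows "g \<circ> f \<in> surface_hom X Z"
proof -
  have "bij_betw (g \<circ> f) (face_boundary X F) (face_boundary Z (g (f F)))" if "F \<in> faces X" for F
    using f g faces[OF that] that unfolding surface_hom_def by (blast intro: bij_betw_trans)
  moreover have bnd: "f A \<in> face_boundary Y (f F)" if "F \<in> faces X" "A \<in> face_boundary X F" for A F
    using f that unfolding surface_hom_def by (blast dest: bij_betwE)
  moreover have "A \<triangleleft>\<^bsub>X\<^esub> B \<longleftrightarrow> g (f A) \<triangleleft>\<^bsub>Z\<^esub> g (f B)"
    if "F \<in> faces X" "A \<in> face_boundary X F" "B \<in> face_boundary X F" for F A B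
  proof -
    have "A \<triangleleft>\<^bsub>X\<^esub> B \<longleftrightarrow> f A \<triangleleft>\<^bsub>Y\<^esub> f B"
      using f that unfolding surface_hom_def by blast
    also have "\<dots> \<longleftrightarrow> g (f A) \<triangleleft>\<^bsub>Z\<^esub> g (f B)"
      using g faces bnd that unfolding surface_hom_def by blast
    finally show ?thesis .
  qed
  moreover have "g \<circ> f \<in> points X \<rightarrow> points Z"
    "\<forall>A \<in> points X. \<forall>B \<in> points X. A \<triangleleft>\<^bsub>X\<^esub> B \<longrightarrow> g (f A) \<triangleleft>\<^bsub>Z\<^esub> g (f B)"
    using f g by (auto simp: surface_hom_def Pi_iff)
  ultimately show ?thesis
    by (simp add: surface_hom_def)
qed

context simplicial_surface
begin

lemma surface_hom_faces:
  assumes \<pi>: "\<pi> \<in> surface_hom X X" and F: "F \<in> faces X"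
  shows "\<pi> F \<in> faces X"
proof -
  have "{e \<in> edges X. e \<triangleleft> F} \<noteq> {}"
    using face_edges[OF F] by (metis card.empty zero_neq_numeral)
  then obtain e where e: "e \<in> edges X" "e \<triangleleft> F" by blast
  have "{V \<in> verts X. V \<triangleleft> e} \<noteq> {}"
    using edge_verts[OF e(1)] by (metis card.empty zero_neq_numeral)
  then obtain V where V: "V \<in> verts X" "V \<triangleleft> e" by blast
  have "\<pi> V \<triangleleft> \<pi> e" "\<pi> e \<triangleleft> \<pi> F"
    using \<pi> e V F by (auto simp: surface_hom_def points_def)
  then show ?thesis
    using inc_subset verts_edges_disjoint verts_faces_disjoint edges_faces_disjoint by blast
qed

lemma group_aut_group: "group (aut_group X)"
proof -
  let ?P = "points X"
  interpret B: group "BijGroup ?P" by (rule group_BijGroup)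
  have "subgroup (surface_auts X) (BijGroup ?P)"
  proof (rule B.subgroupI)
    show "surface_auts X \<subseteq> carrier (BijGroup ?P)"
      by (auto simp: surface_auts_def BijGroup_def)
    have id: "(\<lambda>x. x) \<in> surface_hom X X"
      by (auto simp: surface_hom_def bij_betw_def)
    have "(\<lambda>x\<in>?P. x) \<in> Bij ?P" by (rule id_Bij)
    moreover have "(\<lambda>x\<in>?P. x) \<in> surface_hom X X" by (rule surface_hom_cong[OF id]) simp
    moreover have "inv_into ?P (\<lambda>x\<in>?P. x) x = x" if "x \<in> ?P" for x
      using that by (intro inv_into_f_eq) (auto simp: inj_on_def)
    then have "inv_into ?P (\<lambda>x\<in>?P. x) \<in> surface_hom X X"
      by (intro surface_hom_cong[OF id]) simp
    ultimately show "surface_auts X \<noteq> {}" by (auto simp: surface_auts_def)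
  next
    fix a assume a: "a \<in> surface_auts X"
    then have Bij: "a \<in> Bij ?P" by (simp add: surface_auts_def)
    then have bij: "bij_betw a ?P ?P" by (simp add: Bij_def)
    let ?b = "restrict (inv_into ?P a) ?P"
    have b: "?b \<in> Bij ?P" using Bij by (rule restrict_inv_into_Bij)
    have "?b \<in> surface_hom X X"
      using a surface_hom_cong[of "inv_into ?P a" X X ?b] by (simp add: surface_auts_def)
    moreover have "a x = inv_into ?P ?b x" if "x \<in> ?P" for x
    proof (rule sym, rule inv_into_f_eq)
      show "inj_on ?b ?P" using b by (simp add: Bij_def bij_betw_def)
      show "a x \<in> ?P" using bij that by (auto dest: bij_betwE)
      then show "?b (a x) = x" using bij that by (simp add: bij_betw_inv_into_left)
    qed
    then have "inv_into ?P ?b \<in> surface_hom X X"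
      using a surface_hom_cong[of a X X "inv_into ?P ?b"] by (simp add: surface_auts_def)
    ultimately show "inv\<^bsub>BijGroup ?P\<^esub> a \<in> surface_auts X"
      using b by (simp add: inv_BijGroup[OF Bij] surface_auts_def)
  next
    fix a c assume a: "a \<in> surface_auts X" and c: "c \<in> surface_auts X"
    then have Bij: "a \<in> Bij ?P" "c \<in> Bij ?P" by (auto simp: surface_auts_def)
    then have bij: "bij_betw a ?P ?P" "bij_betw c ?P ?P" by (auto simp: Bij_def)
    let ?d = "compose ?P a c"
    have d: "?d \<in> Bij ?P" using Bij by (rule compose_Bij)
    have "a \<circ> c \<in> surface_hom X X"
      using a c by (intro surface_hom_comp) (auto simp: surface_auts_def surface_hom_faces)
    then have "?d \<in> surface_hom X X"
      by (rule surface_hom_cong) (simp add: compose_def)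
    moreover have "inv_into ?P c \<circ> inv_into ?P a \<in> surface_hom X X"
      using a c by (intro surface_hom_comp) (auto simp: surface_auts_def surface_hom_faces)
    moreover have "(inv_into ?P c \<circ> inv_into ?P a) x = inv_into ?P ?d x" if "x \<in> ?P" for x
    proof (rule sym, rule inv_into_f_eq)
      have x: "inv_into ?P a x \<in> ?P" using bij that by (metis bij_betwE bij_betw_inv_into)
      then have y: "inv_into ?P c (inv_into ?P a x) \<in> ?P"
        using bij by (metis bij_betwE bij_betw_inv_into)
      show "inj_on ?d ?P" using d by (simp add: Bij_def bij_betw_def)
      show "(inv_into ?P c \<circ> inv_into ?P a) x \<in> ?P" using y by simp
      then show "?d ((inv_into ?P c \<circ> inv_into ?P a) x) = x"
        using bij that x by (simp add: compose_def bij_betw_inv_into_right)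
    qed
    then have "inv_into ?P ?d \<in> surface_hom X X"
      using calculation(2) by (metis surface_hom_cong)
    ultimately show "a \<otimes>\<^bsub>BijGroup ?P\<^esub> c \<in> surface_auts X"
      using d Bij by (simp add: BijGroup_def surface_auts_def)
  qed
  then show ?thesis
    unfolding aut_group_def by (rule subgroup.subgroup_is_group) (rule group_BijGroup)
qed

end

datatype node = An nat | Bn nat | Cn nat | Dn nat | En nat | Fn nat

definition gamma_nodes :: "nat \<Rightarrow> node set" where
  "gamma_nodes n = (\<Union>i \<in> {1..n}. {An i, Bn i, Cn i, Dn i, En i, Fn i})"

definition gamma_edges :: "nat \<Rightarrow> node set set" where
  "gamma_edges n =
     (\<Union>i \<in> {1..n}. {{An i, Bn i}, {An i, En i}, {An i, Fn i}, {Bn i, Fn i},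
                     {Cn i, Dn i}, {Cn i, Fn i}, {Cn i, En i}}) \<union>
     (\<Union>j \<in> {1..<n}. {{Bn (j + 1), En j}, {Dn j, Dn (j + 1)}}) \<union>
     {{Bn 1, En n}, {Dn 1, Dn n}}"

definition gamma :: "nat \<Rightarrow> (node, node set) mgraph" where
  "gamma n = \<lparr>nodes = gamma_nodes n, links = gamma_edges n, ends = (\<lambda>e. e)\<rparr>"

lemma mgraph_gamma: "n > 2 \<Longrightarrow> mgraph (gamma n)"
  by (auto simp: mgraph_def gamma_def gamma_nodes_def gamma_edges_def card_insert_if)

end

theory Submission
  imports Defs
begin

text \<open>
  The graph consists of \<open>n\<close> copies of a cell with the six nodes \<open>a, b, c, d, e, f\<close>, arranged in a ring.
  Drawn in this way it has five kinds of regions: in each cell a triangle \<open>a b f\<close> and a quadrangle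
  \<open>a f c e\<close>, between any two consecutive cells a heptagon, an inner region bounded by the cycle
  of the \<open>d\<close> and an outer region bounded by the cycle of length \<open>3n\<close> through the \<open>b, a, e\<close>. The
  surface is the dual of this drawing: its vertices are the regions, its faces the nodes and its
  edges the edges of the graph. The incidences are tabulated for one cell, with cell indices read
  cyclically, so that the axioms of a simplicial surface reduce to finitely many cases; the umbrella
  of a vertex is the boundary cycle of its region. The surface has \<open>3n + 2\<close> vertices, \<open>9n\<close> edges and
  \<open>6n\<close> faces, hence Euler characteristic 2.

  The rotations of the ring are automorphisms of the surface. Conversely, an automorphism preserves
  degrees, therefore fixes the vertex \<open>Outer\<close> of degree \<open>3n\<close>, and rotates or reflects the cycle of its
  neighbours. These are the triangles, quadrangles and heptagons in cyclic order \<open>3, 4, 7, 3, 4, 7, \<dots>\<close>;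
  the pattern of degrees is not symmetric under reversal, so only the \<open>n\<close> rotations remain. As the
  surface is vertex-faithful, the action on the vertices determines the automorphism
  (\<open>aut_eqI\<close>, \<open>aut_is_rot\<close>).

  For 3-connectedness the two long cycles serve as backbones: after the removal of two nodes, one of
  them together with its surroundings is still connected, and everything else is attached to it
  (\<open>colouring_constant\<close>). For planarity the cells are drawn by straight segments in consecutive
  rectangles of a strip, and the strip is rolled up to an annulus by the exponential function
  (\<open>wrap_on_unique\<close>, \<open>edge_path_image\<close>).
\<close>

section \<open>Cyclic indices\<close>

locale cyclic_index =
  fixes n :: nat
  assumes n_gt_2: "n > 2"
begin

abbreviation I :: "nat set" where "I \<equiv> {1..n}"

text \<open>Cells are numbered from \<open>1\<close>, whence the corrections by one around the reduction modulo \<open>n\<close>.\<close>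

definition shift :: "int \<Rightarrow> nat \<Rightarrow> nat" where
  "shift k i = nat ((int i - 1 + k) mod int n) + 1"

abbreviation nx :: "nat \<Rightarrow> nat" where "nx \<equiv> shift 1"
abbreviation pv :: "nat \<Rightarrow> nat" where "pv \<equiv> shift (-1)"

lemma shift_mem: "shift k i \<in> I"
proof -
  have "0 \<le> (int i - 1 + k) mod int n" "(int i - 1 + k) mod int n < int n"
    using n_gt_2 by simp_all
  then show ?thesis by (auto simp: shift_def nat_less_iff Suc_le_eq)
qed

lemma shift_bounds [simp]: "Suc 0 \<le> shift k i" "shift k i \<le> n"
  using shift_mem[of k i] by auto

lemma shift_shift: "shift a (shift b i) = shift (a + b) i"
proof -
  have "0 \<le> (int i - 1 + b) mod int n" using n_gt_2 by simp
  then have "int (shift b i) - 1 = (int i - 1 + b) mod int n" by (simp add: shift_def)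
  then show ?thesis
    unfolding shift_def[of a] shift_def[of "a + b"] by (simp add: mod_simps algebra_simps)
qed

lemma shift_0: "i \<in> I \<Longrightarrow> shift 0 i = i"
  by (auto simp: shift_def)

lemma shift_mod: "shift (k mod int n) i = shift k i"
  by (simp add: shift_def mod_simps)

lemma shift_one_eq_iff: "shift a 1 = shift b 1 \<longleftrightarrow> a mod int n = b mod int n"
  using n_gt_2 by (simp add: shift_def nat_eq_iff)

lemma shift_eq_iff:
  assumes "i \<in> I" "j \<in> I"
  shows "shift k i = shift k j \<longleftrightarrow> i = j"
  using assms shift_shift[of "-k" k] shift_0 by (metis add.left_inverse)

lemma shift_nx: "shift k (nx i) = nx (shift k i)"
  by (simp add: shift_shift add.commute)

lemma nx_eq: "i \<in> I \<Longrightarrow> nx i = (if i = n then 1 else Suc i)"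
  by (auto simp: shift_def)

lemma pv_nx [simp]: "i \<in> I \<Longrightarrow> pv (nx i) = i"
  and nx_pv [simp]: "i \<in> I \<Longrightarrow> nx (pv i) = i"
  by (simp_all only: shift_shift) (simp_all add: shift_0)

lemma nx_neq: "i \<in> I \<Longrightarrow> nx i \<noteq> i"
  using n_gt_2 by (simp add: nx_eq)

lemma nx_nx_neq: "i \<in> I \<Longrightarrow> nx (nx i) \<noteq> i"
  using n_gt_2 shift_mem[of 1 i] by (auto simp: nx_eq)

lemma pv_neq: "i \<in> I \<Longrightarrow> pv i \<noteq> i"
  by (metis nx_neq nx_pv)

lemma pv_neq_nx: "i \<in> I \<Longrightarrow> pv i \<noteq> nx i"
  by (metis nx_nx_neq nx_pv)

text \<open>
  A cycle with one node removed is still a path: start at the successor of the removed node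
  and walk forwards.
\<close>

lemma cycle_minus_one_connected:
  assumes r: "r \<in> I"
    and step: "\<And>i. i \<in> I \<Longrightarrow> i \<noteq> r \<Longrightarrow> nx i \<noteq> r \<Longrightarrow> P i = P (nx i)"
    and ij: "i \<in> I" "j \<in> I" "i \<noteq> r" "j \<noteq> r"
  shows "P i = P j"
proof -
  have walk: "m < n - 1 \<longrightarrow> P (shift (int m + 1) r) = P (nx r)" for m
  proof (induction m)
    case (Suc m)
    let ?k = "shift (int m + 1) r"
    have neq: "shift (int l) r \<noteq> r" if "0 < l" "l < n" for l
    proof
      assume *: "shift (int l) r = r"
      have r1: "shift (int r - 1) 1 = r" using r by (auto simp: shift_def)
      then have "shift (int r - 1) (shift (int l) 1) = shift (int r - 1) 1"
        using * by (metis add.commute shift_shift)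
      then have "shift (int l) 1 = 1"
        using shift_eq_iff[OF shift_mem] n_gt_2 by auto
      then have "shift (int l) 1 = shift 0 1"
        using n_gt_2 by (simp add: shift_0)
      then have "int l mod int n = 0 mod int n" by (simp only: shift_one_eq_iff)
      then show False using that by simp
    qed
    show ?case
    proof
      assume m: "Suc m < n - 1"
      have "nx ?k = shift (int (Suc m) + 1) r"
        by (simp add: shift_shift algebra_simps)
      moreover have "?k \<noteq> r" "shift (int (Suc m) + 1) r \<noteq> r"
        using neq[of "Suc m"] neq[of "Suc (Suc m)"] m by (simp_all add: add.commute)
      ultimately have "P ?k = P (shift (int (Suc m) + 1) r)"
        using step[of ?k] shift_mem by metis
      then show "P (shift (int (Suc m) + 1) r) = P (nx r)"
        using Suc.IH m by simp
    qed
  qed simp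
  have "P k = P (nx r)" if k: "k \<in> I" "k \<noteq> r" for k
  proof -
    define m where "m = nat ((int k - int r - 1) mod int n)"
    have m: "int m = (int k - int r - 1) mod int n" using n_gt_2 by (simp add: m_def)
    have "(int r - 1 + (int m + 1)) mod int n = (int k - 1) mod int n"
      unfolding m by (simp add: mod_simps)
    then have s: "shift (int m + 1) r = k"
      using k by (simp add: shift_def) linarith
    have "m < n"
      using m n_gt_2 pos_mod_bound[of "int n" "int k - int r - 1"] by linarith
    moreover have "m \<noteq> n - 1"
    proof
      assume "m = n - 1"
      then have "shift (int m + 1) r = shift (int n mod int n) r"
        unfolding shift_mod using n_gt_2 by (simp add: of_nat_diff)
      then show False using s k r by (simp add: shift_0)
    qed
    ultimately show ?thesis using walk[of m] s by simp
  qed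
  then show ?thesis using ij by metis
qed

end

section \<open>The surface\<close>

text \<open>
  The vertices are the regions of the plane drawing of the graph: \<open>Outer\<close> is bounded by the cycle
  through all \<open>b\<^sub>i, a\<^sub>i, e\<^sub>i\<close>, \<open>Inner\<close> by the cycle through all \<open>d\<^sub>i\<close>, \<open>Tri i\<close> by the triangle
  \<open>a\<^sub>i b\<^sub>i f\<^sub>i\<close>, \<open>Quad i\<close> by the cycle \<open>a\<^sub>i f\<^sub>i c\<^sub>i e\<^sub>i\<close>, and \<open>Hept i\<close> by the cycle of seven nodes
  between the cells \<open>i - 1\<close> and \<open>i\<close>.
\<close>

datatype vert = Outer | Inner | Tri nat | Quad nat | Hept nat

text \<open>
  The name of an edge kind lists the end nodes of the edge in the graph. \<open>eEB\<close> and \<open>eDD\<close> lead from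
  cell \<open>i\<close> to the next one; all others stay inside their cell.
\<close>

datatype ekind = eAB | eAE | eAF | eBF | eCD | eCF | eCE | eEB | eDD

type_synonym edge = "ekind \<times> nat"

datatype point = Vert vert | Edge edge | Face node

instance vert :: countable by countable_datatype
instance ekind :: countable by countable_datatype
instance node :: countable by countable_datatype
instance point :: countable by countable_datatype

lemma UNIV_ekind: "(UNIV :: ekind set) = {eAB, eAE, eAF, eBF, eCD, eCF, eCE, eEB, eDD}"
  using ekind.exhaust by blast

context cyclic_index
begin

definition V :: "vert set" where
  "V = {Outer, Inner} \<union> Tri ` I \<union> Quad ` I \<union> Hept ` I"

abbreviation N :: "node set" where "N \<equiv> gamma_nodes n"

abbreviation E :: "edge set" where "E \<equiv> UNIV \<times> I"

fun corners :: "node \<Rightarrow> vert set" where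
  "corners (An i) = {Tri i, Quad i, Outer}"
| "corners (Bn i) = {Tri i, Hept i, Outer}"
| "corners (Cn i) = {Quad i, Hept i, Hept (nx i)}"
| "corners (Dn i) = {Hept i, Hept (nx i), Inner}"
| "corners (En i) = {Quad i, Hept (nx i), Outer}"
| "corners (Fn i) = {Tri i, Quad i, Hept i}"

fun edge_verts :: "edge \<Rightarrow> vert set" where
  "edge_verts (eAB, i) = {Tri i, Outer}"
| "edge_verts (eAE, i) = {Quad i, Outer}"
| "edge_verts (eAF, i) = {Tri i, Quad i}"
| "edge_verts (eBF, i) = {Tri i, Hept i}"
| "edge_verts (eCD, i) = {Hept i, Hept (nx i)}"
| "edge_verts (eCF, i) = {Quad i, Hept i}"
| "edge_verts (eCE, i) = {Quad i, Hept (nx i)}"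
| "edge_verts (eEB, i) = {Hept (nx i), Outer}"
| "edge_verts (eDD, i) = {Hept (nx i), Inner}"

fun edge_nodes :: "edge \<Rightarrow> node set" where
  "edge_nodes (eAB, i) = {An i, Bn i}"
| "edge_nodes (eAE, i) = {An i, En i}"
| "edge_nodes (eAF, i) = {An i, Fn i}"
| "edge_nodes (eBF, i) = {Bn i, Fn i}"
| "edge_nodes (eCD, i) = {Cn i, Dn i}"
| "edge_nodes (eCF, i) = {Cn i, Fn i}"
| "edge_nodes (eCE, i) = {Cn i, En i}"
| "edge_nodes (eEB, i) = {Bn (nx i), En i}"
| "edge_nodes (eDD, i) = {Dn i, Dn (nx i)}"

fun node_edges :: "node \<Rightarrow> edge set" where
  "node_edges (An i) = {(eAB, i), (eAE, i), (eAF, i)}"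
| "node_edges (Bn i) = {(eAB, i), (eBF, i), (eEB, pv i)}"
| "node_edges (Cn i) = {(eCD, i), (eCF, i), (eCE, i)}"
| "node_edges (Dn i) = {(eCD, i), (eDD, i), (eDD, pv i)}"
| "node_edges (En i) = {(eAE, i), (eCE, i), (eEB, i)}"
| "node_edges (Fn i) = {(eAF, i), (eBF, i), (eCF, i)}"

text \<open>The cycle \<open>b\<^sub>1, a\<^sub>1, e\<^sub>1, b\<^sub>2, a\<^sub>2, e\<^sub>2, \<dots>\<close> around the outer region.\<close>

definition rim :: "nat \<Rightarrow> node" where
  "rim m = (if m mod 3 = 0 then Bn else if m mod 3 = 1 then An else En) (Suc (m div 3))"

text \<open>The boundary cycle of each region, which is the umbrella of the corresponding vertex.\<close>

fun ring :: "vert \<Rightarrow> node list" where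
  "ring Outer = map rim [0..<3 * n]"
| "ring Inner = map Dn [1..<Suc n]"
| "ring (Tri i) = [An i, Bn i, Fn i]"
| "ring (Quad i) = [An i, En i, Cn i, Fn i]"
| "ring (Hept i) = [Bn i, Fn i, Cn i, Dn i, Dn (pv i), Cn (pv i), En (pv i)]"

lemma mem_V [simp]:
  "Outer \<in> V" "Inner \<in> V" "Tri i \<in> V \<longleftrightarrow> i \<in> I" "Quad i \<in> V \<longleftrightarrow> i \<in> I" "Hept i \<in> V \<longleftrightarrow> i \<in> I"
  by (auto simp: V_def)

lemma mem_N [simp]:
  "An i \<in> N \<longleftrightarrow> i \<in> I" "Bn i \<in> N \<longleftrightarrow> i \<in> I" "Cn i \<in> N \<longleftrightarrow> i \<in> I"
  "Dn i \<in> N \<longleftrightarrow> i \<in> I" "En i \<in> N \<longleftrightarrow> i \<in> I" "Fn i \<in> N \<longleftrightarrow> i \<in> I"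
  by (auto simp: gamma_nodes_def)

lemma card_V: "card V = 3 * n + 2" and finite_V: "finite V"
proof -
  have *: "V = insert Outer (insert Inner (Tri ` I \<union> (Quad ` I \<union> Hept ` I)))"
    by (auto simp: V_def)
  show "finite V" by (simp add: V_def)
  have "card (Tri ` I \<union> (Quad ` I \<union> Hept ` I)) = 3 * n"
    by (subst card_Un_disjoint; (auto simp: card_image inj_on_def)?)+
  then show "card V = 3 * n + 2"
    unfolding * by (subst card_insert_disjoint; auto)+
qed

lemma card_N: "card N = 6 * n" and finite_N: "finite N"
proof -
  have *: "N = An ` I \<union> (Bn ` I \<union> (Cn ` I \<union> (Dn ` I \<union> (En ` I \<union> Fn ` I))))"
    by (auto simp: gamma_nodes_def)
  show "finite N" by (simp add: *)
  show "card N = 6 * n"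
    unfolding * by (subst card_Un_disjoint; (auto simp: card_image inj_on_def)?)+
qed

lemma card_E: "card E = 9 * n" and finite_E: "finite E"
  by (simp_all add: card_cartesian_product UNIV_ekind)

lemmas nx_neqs = nx_neq nx_neq[symmetric] pv_neq pv_neq[symmetric] pv_neq_nx pv_neq_nx[symmetric]

lemma edge_verts_subset: "e \<in> E \<Longrightarrow> edge_verts e \<subseteq> V"
  by (cases e rule: edge_verts.cases) auto

lemma card_edge_verts: "e \<in> E \<Longrightarrow> card (edge_verts e) = 2"
  by (cases e rule: edge_verts.cases) (auto simp: card_insert_if nx_neqs)

lemma corners_subset: "f \<in> N \<Longrightarrow> corners f \<subseteq> V"
  by (cases f) auto

lemma card_corners: "f \<in> N \<Longrightarrow> card (corners f) = 3"
  by (cases f) (auto simp: card_insert_if nx_neqs)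

lemma edge_nodes_subset: "e \<in> E \<Longrightarrow> edge_nodes e \<subseteq> N"
  by (cases e rule: edge_nodes.cases) auto

lemma card_edge_nodes: "e \<in> E \<Longrightarrow> card (edge_nodes e) = 2"
  by (cases e rule: edge_nodes.cases) (auto simp: card_insert_if nx_neqs)

lemma node_edges_iff: "f \<in> N \<Longrightarrow> e \<in> node_edges f \<longleftrightarrow> e \<in> E \<and> f \<in> edge_nodes e"
  by (cases f; cases e rule: edge_nodes.cases) auto

lemma card_node_edges: "f \<in> N \<Longrightarrow> card (node_edges f) = 3"
  by (cases f) (auto simp: card_insert_if nx_neqs)

lemma card_node_edges_at:
  assumes "f \<in> N" "v \<in> corners f"
  shows "card {e \<in> node_edges f. v \<in> edge_verts e} = 2"
proof -
  have "card (node_edges f \<inter> {e. v \<in> edge_verts e}) = 2"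
    using assms by (cases f) (auto simp: card_insert_if nx_neqs)
  then show ?thesis by (simp add: Int_def)
qed

lemma rim_eq:
  assumes "i \<in> I"
  shows "rim (3 * i - 3) = Bn i" "rim (3 * i - 2) = An i" "rim (3 * i - 1) = En i"
proof -
  obtain q where i: "i = Suc q" using assms by (cases i) auto
  have "(3 * q + 1) div 3 = q" "(3 * q + 2) div 3 = q" "(3 * q + 1) mod 3 = 1" "(3 * q + 2) mod 3 = 2"
    by presburger+
  then show "rim (3 * i - 3) = Bn i" "rim (3 * i - 2) = An i" "rim (3 * i - 1) = En i"
    unfolding i by (simp_all add: rim_def)
qed

lemma inj_rim: "inj rim"
proof (rule injI)
  fix x y assume "rim x = rim y"
  then have "x mod 3 = y mod 3" "x div 3 = y div 3"
    by (auto simp: rim_def split: if_splits)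
  then show "x = y" by (metis mult_div_mod_eq)
qed

lemma rim_image: "rim ` {0..<3 * n} = Bn ` I \<union> An ` I \<union> En ` I"
proof
  show "rim ` {0..<3 * n} \<subseteq> Bn ` I \<union> An ` I \<union> En ` I"
    by (auto simp: rim_def)
  have "Bn i \<in> rim ` {0..<3 * n} \<and> An i \<in> rim ` {0..<3 * n} \<and> En i \<in> rim ` {0..<3 * n}"
    if "i \<in> I" for i
  proof -
    have "3 * i - 3 \<in> {0..<3 * n}" "3 * i - 2 \<in> {0..<3 * n}" "3 * i - 1 \<in> {0..<3 * n}"
      using that by auto
    then show ?thesis using rim_eq[OF that] by (metis imageI)
  qed
  then show "Bn ` I \<union> An ` I \<union> En ` I \<subseteq> rim ` {0..<3 * n}" by auto
qed

lemma set_ring: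
  assumes "v \<in> V"
  shows "set (ring v) = {f \<in> N. v \<in> corners f}"
proof (rule Set.set_eqI)
  fix f show "f \<in> set (ring v) \<longleftrightarrow> f \<in> {f \<in> N. v \<in> corners f}"
    using assms by (cases v; cases f) (auto simp: rim_image[simplified])
qed

lemma distinct_ring: "v \<in> V \<Longrightarrow> distinct (ring v)"
  by (cases v) (auto simp: distinct_map inj_on_def nx_neqs dest: injD[OF inj_rim])

lemma length_ring:
  "length (ring v) = (case v of Outer \<Rightarrow> 3 * n | Inner \<Rightarrow> n | Tri i \<Rightarrow> 3 | Quad i \<Rightarrow> 4 | Hept i \<Rightarrow> 7)"
  by (cases v) auto

lemma ring_consecutive:
  assumes "v \<in> V" "m < length (ring v)"
  shows "\<exists>e \<in> E. v \<in> edge_verts e \<and> ring v ! m \<in> edge_nodes e \<and>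
    ring v ! (Suc m mod length (ring v)) \<in> edge_nodes e"
proof -
  define P where "P f g \<longleftrightarrow> (\<exists>e \<in> E. v \<in> edge_verts e \<and> f \<in> edge_nodes e \<and> g \<in> edge_nodes e)"
    for f g
  have PI: "P f g" if "i \<in> I" "v \<in> edge_verts (k, i)" "f \<in> edge_nodes (k, i)" "g \<in> edge_nodes (k, i)"
    for f g k i
    using that by (force simp: P_def)
  consider "v = Outer" | "v = Inner" | i where "i \<in> I" "v = Tri i \<or> v = Quad i \<or> v = Hept i"
    using assms(1) by (cases v) auto
  then have "P (ring v ! m) (ring v ! (Suc m mod length (ring v)))"
  proof cases
    case 1
    then have m: "m < 3 * n" using assms(2) by simp
    define i where "i = Suc (m div 3)"
    have i: "i \<in> I" using m by (auto simp: i_def Suc_le_eq less_mult_imp_div_less mult.commute)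
    have "m = 3 * i - 3 \<or> m = 3 * i - 2 \<or> m = 3 * i - 1" by (simp add: i_def) presburger
    moreover have "P (Bn i) (An i)" "P (An i) (En i)" "P (En i) (Bn (nx i))"
      using i 1 PI[of i eAB] PI[of i eAE] PI[of i eEB] by auto
    moreover have "Suc (3 * i - 3) mod (3 * n) = 3 * i - 2" "Suc (3 * i - 2) mod (3 * n) = 3 * i - 1"
      using i by (auto intro!: mod_less[THEN trans])
    moreover have "Suc (3 * i - 1) mod (3 * n) = 3 * nx i - 3"
      using i by (auto simp: nx_eq)
    moreover have "ring v ! l = rim l" if "l < 3 * n" for l using 1 that by simp
    moreover have "Suc m mod (3 * n) < 3 * n" using n_gt_2 by simp
    moreover have "length (ring v) = 3 * n" using 1 by simp
    ultimately show ?thesis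
      using m rim_eq[OF i] rim_eq(1)[OF shift_mem, of 1 i] by metis
  next
    case 2
    then have m: "m < n" using assms(2) by (simp del: upt_Suc)
    then have i: "Suc m \<in> I" by simp
    have "ring v ! m = Dn (Suc m)" using 2 m by (simp del: upt_Suc)
    moreover have "ring v ! (Suc m mod length (ring v)) = Dn (nx (Suc m))"
    proof (cases "Suc m = n")
      case True
      then show ?thesis using 2 m nx_eq[OF i] by (simp del: upt_Suc)
    next
      case False
      then have "Suc m < n" using m by simp
      then show ?thesis using 2 nx_eq[OF i] by (simp del: upt_Suc)
    qed
    ultimately show ?thesis using 2 PI[of "Suc m" eDD] i by simp
  next
    case 3
    \<comment> \<open>The cyclic successor of an entry is the entry at the same position of the rotated list.\<close>
    then have "list_all2 P (ring v) (rotate1 (ring v))"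
      using PI[of i eAB] PI[of i eAE] PI[of i eAF] PI[of i eBF] PI[of i eCF] PI[of i eCE] PI[of i eCD]
        PI[of "pv i" eCD] PI[of "pv i" eCE] PI[of "pv i" eEB] PI[of "pv i" eDD]
      by auto
    then have "P (ring v ! m) (rotate1 (ring v) ! m)"
      using assms(2) by (simp add: list_all2_conv_all_nth)
    then show ?thesis using assms(2) by (simp add: nth_rotate1)
  qed
  then show ?thesis by (simp add: P_def)
qed

text \<open>
  For \<open>n = 2\<close> both \<open>d\<^sub>1\<close> and \<open>d\<^sub>2\<close> would have the corners \<open>Hept 1\<close>, \<open>Hept 2\<close> and \<open>Inner\<close>. In the
  three injectivity lemmas below, \<open>n > 2\<close> enters through the inequality \<open>nx (nx i) \<noteq> i\<close>.
\<close>

lemma inj_corners: "inj_on corners N"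
proof (rule inj_onI)
  fix f g assume f: "f \<in> N" "g \<in> N" and eq: "corners f = corners g"
  have *: "nx i \<noteq> i" "nx (nx i) \<noteq> i" if "Suc 0 \<le> i" "i \<le> n" for i
    using that nx_neq nx_nx_neq by auto
  have "corners f \<subseteq> corners g" "corners g \<subseteq> corners f"
    using eq by simp_all
  then show "f = g"
    using f by (cases f; cases g) (auto simp: * *[symmetric])
qed

lemma inj_edge_verts: "inj_on edge_verts E"
proof (rule inj_onI)
  fix e e' assume e: "e \<in> E" "e' \<in> E" and eq: "edge_verts e = edge_verts e'"
  obtain k i k' i' where [simp]: "e = (k, i)" "e' = (k', i')" by (cases e, cases e')
  have "nx (nx i) \<noteq> i" "nx i \<noteq> i" "nx i' \<noteq> i'" "nx i = nx i' \<longleftrightarrow> i = i'"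
    using e nx_neq nx_nx_neq shift_eq_iff by auto
  then show "e = e'"
    using eq by (cases k; cases k') (auto simp: doubleton_eq_iff)
qed

lemma inj_edge_nodes: "inj_on edge_nodes E"
proof (rule inj_onI)
  fix e e' assume e: "e \<in> E" "e' \<in> E" and eq: "edge_nodes e = edge_nodes e'"
  obtain k i k' i' where [simp]: "e = (k, i)" "e' = (k', i')" by (cases e, cases e')
  have "nx (nx i) \<noteq> i" "nx i \<noteq> i" "nx i' \<noteq> i'" "nx i = nx i' \<longleftrightarrow> i = i'"
    using e nx_neq nx_nx_neq shift_eq_iff by auto
  then show "e = e'"
    using eq by (cases k; cases k') (auto simp: doubleton_eq_iff)
qed

lemma gamma_edges_eq: "gamma_edges n = edge_nodes ` E"
proof -
  have last: "nx n = 1" using n_gt_2 by (simp add: nx_eq)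
  have split: "I = insert n {1..<n}" using n_gt_2 by auto
  have "(\<Union>i \<in> I. {edge_nodes (eEB, i), edge_nodes (eDD, i)}) =
      (\<Union>j \<in> {1..<n}. {edge_nodes (eEB, j), edge_nodes (eDD, j)}) \<union>
      {edge_nodes (eEB, n), edge_nodes (eDD, n)}"
    unfolding split UN_insert by (rule Un_commute)
  also have "(\<Union>j \<in> {1..<n}. {edge_nodes (eEB, j), edge_nodes (eDD, j)}) =
      (\<Union>j \<in> {1..<n}. {{Bn (j + 1), En j}, {Dn j, Dn (j + 1)}})"
  proof (intro SUP_cong refl)
    fix j assume "j \<in> {1..<n}"
    then have "nx j = j + 1" by (simp add: nx_eq)
    then show "{edge_nodes (eEB, j), edge_nodes (eDD, j)} = {{Bn (j + 1), En j}, {Dn j, Dn (j + 1)}}"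
      by (simp only: edge_nodes.simps)
  qed
  also have "{edge_nodes (eEB, n), edge_nodes (eDD, n)} = {{Bn 1, En n}, {Dn 1, Dn n}}"
    by (simp only: edge_nodes.simps last insert_commute[of "Dn n"])
  finally have across: "(\<Union>i \<in> I. {edge_nodes (eEB, i), edge_nodes (eDD, i)}) =
      (\<Union>j \<in> {1..<n}. {{Bn (j + 1), En j}, {Dn j, Dn (j + 1)}}) \<union> {{Bn 1, En n}, {Dn 1, Dn n}}" .
  have all_kinds: "{{An i, Bn i}, {An i, En i}, {An i, Fn i}, {Bn i, Fn i}, {Cn i, Dn i}, {Cn i, Fn i},
      {Cn i, En i}} \<union> {edge_nodes (eEB, i), edge_nodes (eDD, i)} = (\<lambda>k. edge_nodes (k, i)) ` UNIV" for i
    by (simp only: UNIV_ekind image_insert image_empty edge_nodes.simps Un_insert_left Un_empty_left)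
  have "gamma_edges n = (\<Union>i \<in> I. (\<lambda>k. edge_nodes (k, i)) ` UNIV)"
    unfolding gamma_edges_def Un_assoc across[symmetric] UN_Un_distrib[symmetric] all_kinds ..
  then show ?thesis by blast
qed

end

section \<open>The graph is cubic and 3-connected\<close>

context cyclic_index
begin

lemma gamma_cubic: "cubic (gamma n)"
  unfolding cubic_def
proof
  fix v assume "v \<in> nodes (gamma n)"
  then have v: "v \<in> N" by (simp add: gamma_def)
  have "{x \<in> edge_nodes ` E. v \<in> x} = edge_nodes ` node_edges v"
    using node_edges_iff[OF v] by blast
  moreover have "inj_on edge_nodes (node_edges v)"
    using node_edges_iff[OF v] by (intro inj_on_subset[OF inj_edge_nodes]) blast
  ultimately show "card {e \<in> links (gamma n). v \<in> ends (gamma n) e} = 3"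
    using card_node_edges[OF v] by (simp add: gamma_def gamma_edges_eq card_image)
qed

text \<open>
  A graph is connected if its nodes cannot be coloured with two colours, both used, such that every
  edge has ends of the same colour. This form turns the search for paths around the removed set \<open>S\<close>
  into equational reasoning. There are two long cycles, the outer one through all \<open>b\<^sub>i, a\<^sub>i, e\<^sub>i\<close>
  and the inner one through all \<open>d\<^sub>i\<close>. If \<open>S\<close> avoids all \<open>c\<^sub>i\<close> and \<open>d\<^sub>i\<close>, the inner cycle with the
  adjacent \<open>c\<^sub>i\<close> is intact. Each \<open>f\<^sub>i\<close> and \<open>e\<^sub>i\<close> is adjacent to it, and each \<open>a\<^sub>i\<close> and \<open>b\<^sub>i\<close> reaches it on
  three short paths without common inner nodes, of which two removals can block at most two.
  Otherwise at most one node of the outer cycle is removed, so what is left of it is a path or the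
  whole cycle, and the other nodes are attached to it.
\<close>

lemma colouring_constant:
  fixes Q :: "node \<Rightarrow> bool"
  assumes S: "finite S" "card S < 3"
    and step: "\<And>e u v. e \<in> E \<Longrightarrow> edge_nodes e = {u, v} \<Longrightarrow> u \<notin> S \<Longrightarrow> v \<notin> S \<Longrightarrow> Q u = Q v"
    and u: "u \<in> N - S" and v: "v \<in> N - S"
  shows "Q u = Q v"
proof -
  have three: False if "x \<in> S" "y \<in> S" "z \<in> S" "x \<noteq> y" "x \<noteq> z" "y \<noteq> z" for x y z
  proof -
    have "card {x, y, z} \<le> card S" using S(1) that by (intro card_mono) auto
    then show False using S(2) that by simp
  qed
  have AB: "Q (An i) = Q (Bn i)" if "i \<in> I" "An i \<notin> S" "Bn i \<notin> S" for i
    using step[of "(eAB, i)"] that by simp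
  have AE: "Q (An i) = Q (En i)" if "i \<in> I" "An i \<notin> S" "En i \<notin> S" for i
    using step[of "(eAE, i)"] that by simp
  have AF: "Q (An i) = Q (Fn i)" if "i \<in> I" "An i \<notin> S" "Fn i \<notin> S" for i
    using step[of "(eAF, i)"] that by simp
  have BF: "Q (Bn i) = Q (Fn i)" if "i \<in> I" "Bn i \<notin> S" "Fn i \<notin> S" for i
    using step[of "(eBF, i)"] that by simp
  have CD: "Q (Cn i) = Q (Dn i)" if "i \<in> I" "Cn i \<notin> S" "Dn i \<notin> S" for i
    using step[of "(eCD, i)"] that by simp
  have CF: "Q (Cn i) = Q (Fn i)" if "i \<in> I" "Cn i \<notin> S" "Fn i \<notin> S" for i
    using step[of "(eCF, i)"] that by simp
  have CE: "Q (Cn i) = Q (En i)" if "i \<in> I" "Cn i \<notin> S" "En i \<notin> S" for i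
    using step[of "(eCE, i)"] that by simp
  have EB: "Q (En i) = Q (Bn (nx i))" if "i \<in> I" "En i \<notin> S" "Bn (nx i) \<notin> S" for i
    using step[of "(eEB, i)" "Bn (nx i)" "En i"] that by simp
  have DD: "Q (Dn i) = Q (Dn (nx i))" if "i \<in> I" "Dn i \<notin> S" "Dn (nx i) \<notin> S" for i
    using step[of "(eDD, i)"] that by simp
  have EB': "Q (En (pv i)) = Q (Bn i)" if "i \<in> I" "En (pv i) \<notin> S" "Bn i \<notin> S" for i
    using EB[OF shift_mem, of "-1" i] that by simp
  have DD': "Q (Dn (pv i)) = Q (Dn i)" if "i \<in> I" "Dn (pv i) \<notin> S" "Dn i \<notin> S" for i
    using DD[OF shift_mem, of "-1" i] that by simp
  have one: "1 \<in> I" using n_gt_2 by simp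
  have "\<exists>p. \<forall>w \<in> N - S. Q w = p"
  proof (cases "\<forall>i \<in> I. Cn i \<notin> S \<and> Dn i \<notin> S")
    case True
    define p where "p = Q (Dn 1)"
    have neq: "nx 1 \<noteq> 1" by (rule nx_neq[OF one])
    have "Q (Dn i) = Q (Dn (nx 1))" if "i \<in> I" "i \<noteq> 1" for i
    proof (rule cycle_minus_one_connected[OF one _ that(1) shift_mem that(2) neq])
      show "Q (Dn i) = Q (Dn (nx i))" if "i \<in> I" for i
        using DD[OF that] True that shift_mem by blast
    qed
    moreover have "Q (Dn (nx 1)) = p"
      using DD[OF one] True one shift_mem unfolding p_def by blast
    ultimately have D: "Q (Dn i) = p" if "i \<in> I" for i
      using that p_def by metis
    have C: "Q (Cn i) = p" if "i \<in> I" for i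
      using CD D True that by metis
    have F: "Q (Fn i) = p" if "i \<in> I" "Fn i \<notin> S" for i
      using CF C True that by metis
    have E: "Q (En i) = p" if "i \<in> I" "En i \<notin> S" for i
      using CE C True that by metis
    \<comment> \<open>The third way from \<open>a\<^sub>i\<close> to the backbone leads through \<open>b\<^sub>i\<close> into the previous cell.\<close>
    have A: "Q (An i) = p" if i: "i \<in> I" "An i \<notin> S" for i
    proof (cases "Fn i \<in> S \<and> En i \<in> S")
      case True
      then have "Bn i \<notin> S" "En (pv i) \<notin> S"
        using three[of "Fn i" "En i"] pv_neq[OF i(1)] by (metis node.distinct node.inject(5))+
      then show ?thesis using AB EB' E[OF shift_mem] i by metis
    next
      case False
      then show ?thesis using AF AE F E i by metis
    qed
    have B: "Q (Bn i) = p" if i: "i \<in> I" "Bn i \<notin> S" for i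
    proof (cases "Fn i \<in> S \<and> En (pv i) \<in> S")
      case True
      then have "An i \<notin> S"
        using three[of "Fn i" "En (pv i)" "An i"] by auto
      then show ?thesis using AB A i by metis
    next
      case False
      then show ?thesis using BF EB' F E[OF shift_mem] i by metis
    qed
    have "Q w = p" if "w \<in> N - S" for w
      using that A B C D E F by (cases w) auto
    then show ?thesis by blast
  next
    case False
    then obtain z where z: "z \<in> S" "\<exists>j. z = Cn j \<or> z = Dn j" by blast
    have two: False if "x \<in> S" "y \<in> S" "x \<noteq> y" "\<nexists>j. x = Cn j \<or> x = Dn j" "\<nexists>j. y = Cn j \<or> y = Dn j"
      for x y
      using three[OF that(1,2) z(1) that(3)] z(2) that(4,5) by blast
    \<comment> \<open>Apart from cell \<open>r\<close> the outer cycle is intact.\<close>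
    obtain r where r: "r \<in> I" "\<And>i. i \<in> I \<Longrightarrow> i \<noteq> r \<Longrightarrow> An i \<notin> S \<and> Bn i \<notin> S \<and> En i \<notin> S"
    proof (cases "\<exists>r \<in> I. An r \<in> S \<or> Bn r \<in> S \<or> En r \<in> S")
      case True
      then obtain r where r: "r \<in> I" "An r \<in> S \<or> Bn r \<in> S \<or> En r \<in> S" by blast
      then obtain x where x: "x \<in> S" "x = An r \<or> x = Bn r \<or> x = En r" by blast
      show ?thesis
      proof (rule that[OF r(1)])
        fix i assume "i \<in> I" "i \<noteq> r"
        then show "An i \<notin> S \<and> Bn i \<notin> S \<and> En i \<notin> S"
          using two[OF x(1)] x(2) by (metis node.distinct node.inject)
      qed
    next
      case False
      then show ?thesis using that[OF one] by blast
    qed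
    define p where "p = Q (Bn (nx r))"
    have top: "Q (Bn i) = p" "Q (An i) = p" "Q (En i) = p" if i: "i \<in> I" "i \<noteq> r" for i
    proof -
      have AE': "Q (An j) = Q (Bn j)" "Q (An j) = Q (En j)" if "j \<in> I" "j \<noteq> r" for j
        using AB AE r(2) that by auto
      show "Q (Bn i) = p"
        unfolding p_def
      proof (rule cycle_minus_one_connected[OF r(1) _ i(1) shift_mem i(2) nx_neq[OF r(1)]])
        fix j assume j: "j \<in> I" "j \<noteq> r" "nx j \<noteq> r"
        then have "Q (En j) = Q (Bn (nx j))" using EB r(2) shift_mem by metis
        then show "Q (Bn j) = Q (Bn (nx j))" using AE'[OF j(1,2)] by simp
      qed
      then show "Q (An i) = p" "Q (En i) = p" using AE'[OF i] by simp_all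
    qed
    have B: "Q (Bn i) = p" if "i \<in> I" "Bn i \<notin> S" for i
      using top(1)[of i] top(3)[OF shift_mem pv_neq] EB'[of i] r that shift_mem pv_neq by metis
    have E: "Q (En i) = p" if "i \<in> I" "En i \<notin> S" for i
      using top(3)[of i] EB[of i] r that shift_mem nx_neq p_def by metis
    have A: "Q (An i) = p" if "i \<in> I" "An i \<notin> S" for i
      using two[of "Bn i" "En i"] B E AB AE that by blast
    have F: "Q (Fn i) = p" if "i \<in> I" "Fn i \<notin> S" for i
      using two[of "An i" "Bn i"] A B AF BF that by blast
    have C: "Q (Cn i) = p" if "i \<in> I" "Cn i \<notin> S" for i
      using two[of "En i" "Fn i"] E F CE CF that by blast
    \<comment> \<open>If \<open>c\<^sub>i\<close> is removed, one further removal cannot block the ways from \<open>d\<^sub>i\<close> through both of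
      the adjacent cells, which are different because \<open>n > 2\<close>.\<close>
    have D: "Q (Dn i) = p" if i: "i \<in> I" "Dn i \<notin> S" for i
    proof (cases "Cn i \<in> S")
      case True
      have neq: "nx i \<noteq> i" "pv i \<noteq> i" "nx i \<noteq> pv i"
        using nx_neq pv_neq pv_neq_nx i(1) by metis+
      show ?thesis
      proof (cases "Cn (nx i) \<in> S \<or> Dn (nx i) \<in> S")
        case nx: True
        have "Cn (pv i) \<notin> S \<and> Dn (pv i) \<notin> S"
          using three[OF True] nx neq by (metis node.distinct node.inject(3,4))
        then show ?thesis using DD' CD C i shift_mem by metis
      next
        case False
        then show ?thesis using DD CD C i shift_mem by metis
      qed
    next
      case False
      then show ?thesis using CD C i by metis
    qed
    have "Q w = p" if "w \<in> N - S" for w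
      using that A B C D E F by (cases w) auto
    then show ?thesis by blast
  qed
  then show ?thesis using u v by metis
qed

lemma gamma_3_connected: "k_connected 3 (gamma n)"
  unfolding k_connected_def
proof (intro conjI allI impI)
  show "finite (nodes (gamma n))" "3 < card (nodes (gamma n))"
    using finite_N card_N n_gt_2 by (simp_all add: gamma_def)
next
  fix S assume "S \<subseteq> nodes (gamma n)" and card: "card S < 3"
  then have sub: "S \<subseteq> N" by (simp add: gamma_def)
  then have fin: "finite S" using finite_N finite_subset by blast
  let ?G = "delete_nodes (gamma n) S"
  have adj: "(u, v) \<in> adjacent ?G"
    if "e \<in> E" "edge_nodes e = {u, v}" "u \<notin> S" "v \<notin> S" for e u v
  proof -
    have "{u, v} \<in> gamma_edges n" using that(1,2) unfolding gamma_edges_eq by (metis imageI)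
    then show ?thesis using that(3,4) by (auto simp: adjacent_def delete_nodes_def gamma_def)
  qed
  have "(u, w) \<in> (adjacent ?G)\<^sup>*" if "u \<in> N - S" "w \<in> N - S" for u w
  proof -
    have "((u, u) \<in> (adjacent ?G)\<^sup>*) = ((u, w) \<in> (adjacent ?G)\<^sup>*)"
    proof (rule colouring_constant[OF fin card _ that])
      fix e x y assume e: "e \<in> E" "edge_nodes e = {x, y}" "x \<notin> S" "y \<notin> S"
      then have "(x, y) \<in> adjacent ?G" "(y, x) \<in> adjacent ?G"
        using adj[of e x y] adj[of e y x] by (simp_all add: insert_commute)
      then show "((u, x) \<in> (adjacent ?G)\<^sup>*) = ((u, y) \<in> (adjacent ?G)\<^sup>*)"
        by (meson rtrancl.rtrancl_into_rtrancl)
    qed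
    then show ?thesis by simp
  qed
  moreover have "N - S \<noteq> {}"
  proof
    assume "N - S = {}"
    then have "N = S" using sub by blast
    then show False using card card_N n_gt_2 by simp
  qed
  ultimately show "connected_graph ?G"
    by (simp add: connected_graph_def delete_nodes_def gamma_def)
qed

end

section \<open>The graph is planar\<close>

text \<open>
  The drawing is periodic: every cell is a copy of the same figure in a strip of width \<open>3\<close>, and the
  strip is rolled up by an exponential function. The figure consists of straight segments between
  nodes at integer coordinates. It contains its left border, but not its right border, where the
  next cell begins. \<open>offset\<close> gives the position of a node and \<open>segment\<close> the end points of an edge,
  both relative to the lower left corner of their cell.
\<close>

fun offset :: "node \<Rightarrow> complex" where
  "offset (An _) = Complex 1 3"
| "offset (Bn _) = Complex 0 3"
| "offset (Cn _) = Complex 1 1"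
| "offset (Dn _) = Complex 0 0"
| "offset (En _) = Complex 2 3"
| "offset (Fn _) = Complex 1 2"

fun segment :: "ekind \<Rightarrow> complex \<times> complex" where
  "segment eAB = (Complex 0 3, Complex 1 3)"
| "segment eAE = (Complex 1 3, Complex 2 3)"
| "segment eAF = (Complex 1 2, Complex 1 3)"
| "segment eBF = (Complex 0 3, Complex 1 2)"
| "segment eCD = (Complex 0 0, Complex 1 1)"
| "segment eCF = (Complex 1 1, Complex 1 2)"
| "segment eCE = (Complex 1 1, Complex 2 3)"
| "segment eEB = (Complex 2 3, Complex 3 3)"
| "segment eDD = (Complex 0 0, Complex 3 0)"

text \<open>The open segments in terms of equations and inequalities.\<close>

fun on_edge :: "ekind \<Rightarrow> real \<Rightarrow> real \<Rightarrow> bool" where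
  "on_edge eAB x y \<longleftrightarrow> y = 3 \<and> 0 < x \<and> x < 1"
| "on_edge eAE x y \<longleftrightarrow> y = 3 \<and> 1 < x \<and> x < 2"
| "on_edge eAF x y \<longleftrightarrow> x = 1 \<and> 2 < y \<and> y < 3"
| "on_edge eBF x y \<longleftrightarrow> x + y = 3 \<and> 0 < x \<and> x < 1"
| "on_edge eCD x y \<longleftrightarrow> y = x \<and> 0 < x \<and> x < 1"
| "on_edge eCF x y \<longleftrightarrow> x = 1 \<and> 1 < y \<and> y < 2"
| "on_edge eCE x y \<longleftrightarrow> y = 2 * x - 1 \<and> 1 < x \<and> x < 2"
| "on_edge eEB x y \<longleftrightarrow> y = 3 \<and> 2 < x \<and> x < 3"
| "on_edge eDD x y \<longleftrightarrow> y = 0 \<and> 0 < x \<and> x < 3"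

fun node_cell :: "node \<Rightarrow> nat" where
  "node_cell (An i) = i"
| "node_cell (Bn i) = i"
| "node_cell (Cn i) = i"
| "node_cell (Dn i) = i"
| "node_cell (En i) = i"
| "node_cell (Fn i) = i"

fun cell :: "node + edge \<Rightarrow> nat" where
  "cell (Inl f) = node_cell f"
| "cell (Inr e) = snd e"

text \<open>The drawing in a cell is a disjoint union of points for the nodes and open segments for the edges.\<close>

fun on :: "node + edge \<Rightarrow> complex \<Rightarrow> bool" where
  "on (Inl f) w \<longleftrightarrow> w = offset f"
| "on (Inr e) w \<longleftrightarrow> on_edge (fst e) (Re w) (Im w)"

lemma on_range: "on s w \<Longrightarrow> 0 \<le> Re w \<and> Re w < 3"
proof (cases s)
  case (Inl f)
  then show "on s w \<Longrightarrow> ?thesis" by (cases f) auto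
next
  case (Inr e)
  then show "on s w \<Longrightarrow> ?thesis" by (cases "fst e") auto
qed

lemma on_edge_unique: "on_edge k x y \<Longrightarrow> on_edge k' x y \<Longrightarrow> k = k'"
  by (cases k; cases k') auto

lemma offset_not_on_edge: "\<not> on_edge k (Re (offset f)) (Im (offset f))"
  by (cases k; cases f) auto

lemma offset_unique: "offset f = offset g \<Longrightarrow> node_cell f = node_cell g \<Longrightarrow> f = g"
  by (cases f; cases g) auto

lemma on_unique: "on s w \<Longrightarrow> on t w \<Longrightarrow> cell s = cell t \<Longrightarrow> s = t"
  using on_edge_unique offset_not_on_edge offset_unique
  by (cases s; cases t) (auto simp: prod_eq_iff)

lemma segment_on_edge:
  assumes "0 < t" "t < 1"
  shows "on (Inr (k, i)) (linepath (fst (segment k)) (snd (segment k)) t)"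
  using assms by (cases k) (simp_all add: linepath_def algebra_simps)

lemma segment_neq: "fst (segment k) \<noteq> snd (segment k)"
  by (cases k) auto

lemma segment_width:
  assumes "t \<in> {0..1}"
  shows "0 \<le> Re (linepath (fst (segment k)) (snd (segment k)) t)"
    "Re (linepath (fst (segment k)) (snd (segment k)) t) \<le> 3"
  using assms by (cases k; simp add: linepath_def algebra_simps)+

context cyclic_index
begin

text \<open>The strip of \<open>n\<close> cells is rolled up around the origin.\<close>

definition wrap :: "complex \<Rightarrow> complex" where
  "wrap z = exp (2 * of_real pi * \<i> * z / of_nat (3 * n))"

text \<open>The period of the exponential function corresponds to a translation by \<open>3 * n\<close>, the length of the strip.\<close>

lemma wrap_inj:
  assumes "wrap z = wrap z'" "\<bar>Re z - Re z'\<bar> < 3 * real n"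
  shows "z = z'"
proof -
  obtain k :: int where "2 * of_real pi * \<i> * z / of_nat (3 * n) =
      2 * of_real pi * \<i> * z' / of_nat (3 * n) + (of_int (2 * k) * pi) * \<i>"
    using assms(1) unfolding wrap_def exp_eq by blast
  then have "(2 * of_real pi * \<i>) * z = (2 * of_real pi * \<i>) * (z' + of_int k * of_nat (3 * n))"
    using n_gt_2 by (simp add: field_simps)
  then have eq: "z = z' + of_int k * of_nat (3 * n)"
    by (subst (asm) mult_cancel_left) simp
  then have "Re z - Re z' = of_int k * (3 * real n)" by simp
  then have "\<bar>of_int k\<bar> * (3 * real n) < 1 * (3 * real n)"
    using assms(2) by (simp add: abs_mult)
  then have "\<bar>of_int k\<bar> < (1 :: real)"
    using n_gt_2 by (subst (asm) mult_less_cancel_right_pos) simp_all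
  then have "k = 0" by linarith
  then show ?thesis using eq by simp
qed

lemma wrap_period: "wrap (z + of_nat (3 * n)) = wrap z"
proof -
  have "2 * of_real pi * \<i> * (z + of_nat (3 * n)) / of_nat (3 * n) =
      2 * of_real pi * \<i> * z / of_nat (3 * n) + (of_int (2 * 1) * pi) * \<i>"
    using n_gt_2 by (simp add: field_simps)
  then show ?thesis unfolding wrap_def exp_eq by blast
qed

lemma wrap_next_cell:
  assumes "i \<in> I"
  shows "wrap (of_nat (3 * nx i) + w) = wrap (of_nat (3 * i) + (3 + w))"
proof (cases "i = n")
  case True
  then show ?thesis
    using wrap_period[of "3 + w"] assms by (simp add: nx_eq add.commute)
next
  case False
  then show ?thesis using assms by (simp add: nx_eq algebra_simps)
qed

text \<open>
  Since the cells are half-open and numbered from \<open>1\<close> to \<open>n\<close>, real parts in them differ by less than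
  the period, so rolling up identifies no two points of the drawing.
\<close>

lemma wrap_on_unique:
  assumes on: "on s w" "on t w'" and cell: "cell s \<in> I" "cell t \<in> I"
    and eq: "wrap (of_nat (3 * cell s) + w) = wrap (of_nat (3 * cell t) + w')"
  shows "s = t"
proof -
  have range: "0 \<le> Re w" "Re w < 3" "0 \<le> Re w'" "Re w' < 3"
    using on_range on by blast+
  have "1 \<le> real (cell s)" "real (cell s) \<le> real n" "1 \<le> real (cell t)" "real (cell t) \<le> real n"
    using cell by auto
  then have "of_nat (3 * cell s) + w = of_nat (3 * cell t) + w'"
    using range by (intro wrap_inj[OF eq]) (simp add: abs_less_iff)
  then have Re: "3 * real (cell s) + Re w = 3 * real (cell t) + Re w'"
    and Im: "Im w = Im w'"
    by (simp_all add: complex_eq_iff)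
  then have "real (cell s) < real (cell t) + 1" "real (cell t) < real (cell s) + 1"
    using range by linarith+
  then have "cell s = cell t" by linarith
  moreover have "w = w'" using Re Im calculation by (simp add: complex_eq_iff)
  ultimately show ?thesis using on_unique on by blast
qed

definition node_point :: "node \<Rightarrow> complex" where
  "node_point f = wrap (of_nat (3 * node_cell f) + offset f)"

definition edge_path :: "edge \<Rightarrow> real \<Rightarrow> complex" where
  "edge_path e t =
     wrap (of_nat (3 * snd e) + linepath (fst (segment (fst e))) (snd (segment (fst e))) t)"

lemma edge_path_arc: "arc (edge_path e)"
proof -
  let ?l = "linepath (fst (segment (fst e))) (snd (segment (fst e)))"
  have "continuous_on {0..1} (edge_path e)"
    unfolding edge_path_def wrap_def linepath_def using n_gt_2 by (intro continuous_intros) auto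
  moreover have "inj_on (edge_path e) {0..1}"
  proof (rule inj_onI)
    fix s t :: real assume st: "s \<in> {0..1}" "t \<in> {0..1}" and eq: "edge_path e s = edge_path e t"
    have "\<bar>Re (?l s) - Re (?l t)\<bar> < 3 * real n"
      using segment_width[OF st(1), of "fst e"] segment_width[OF st(2), of "fst e"] n_gt_2
      by (simp add: abs_less_iff)
    then have "?l s = ?l t"
      using wrap_inj[OF eq[unfolded edge_path_def]] by simp
    moreover have "inj_on ?l {0..1}"
      using arc_linepath[OF segment_neq] by (simp add: arc_def)
    ultimately show "s = t" using st by (simp add: inj_on_def)
  qed
  ultimately show ?thesis by (simp add: arc_def path_def)
qed

lemma edge_path_ends:
  assumes "e \<in> E"
  shows "{pathstart (edge_path e), pathfinish (edge_path e)} = node_point ` edge_nodes e"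
proof -
  have *: "Complex 3 y = 3 + Complex 0 y" for y by (simp add: complex_eq_iff)
  show ?thesis
    using assms wrap_next_cell[of "snd e"]
    by (cases e rule: edge_nodes.cases)
      (simp_all add: pathstart_def pathfinish_def edge_path_def node_point_def linepath_def
        insert_commute *)
qed

text \<open>
  All incidences in the drawing follow from this case distinction: node points and the insides of
  edges are disjoint by \<open>wrap_on_unique\<close>, and an end point on the right border of a cell has already
  been identified with a node of the next cell.
\<close>

lemma edge_path_image:
  assumes e: "e \<in> E" and z: "z \<in> path_image (edge_path e)"
  obtains f where "f \<in> edge_nodes e" "z = node_point f"
  | w where "on (Inr e) w" "z = wrap (of_nat (3 * cell (Inr e)) + w)"
proof -
  obtain t where t: "t \<in> {0..1}" "z = edge_path e t" using z by (auto simp: path_image_def)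
  consider "t = 0 \<or> t = 1" | "0 < t" "t < 1" using t(1) by force
  then show ?thesis
  proof cases
    case 1
    then have "z \<in> node_point ` edge_nodes e"
      unfolding edge_path_ends[OF e, symmetric] t(2) by (auto simp: pathstart_def pathfinish_def)
    then show ?thesis using that(1) by blast
  next
    case 2
    then show ?thesis
      using that(2) segment_on_edge[of t "fst e" "snd e"] t(2) by (simp add: edge_path_def)
  qed
qed

lemma node_cell_mem: "f \<in> N \<Longrightarrow> node_cell f \<in> I"
  by (cases f) auto

lemma inj_node_point: "inj_on node_point N"
proof (rule inj_onI)
  fix f g assume fg: "f \<in> N" "g \<in> N" and "node_point f = node_point g"
  then have "Inl f = (Inl g :: node + edge)"
    using node_cell_mem by (intro wrap_on_unique[of _ "offset f" _ "offset g"])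
      (simp_all add: node_point_def)
  then show "f = g" by simp
qed

lemma node_point_not_inside:
  assumes "e \<in> E" "f \<in> N" "on (Inr e) w"
  shows "node_point f \<noteq> wrap (of_nat (3 * cell (Inr e)) + w)"
proof
  assume "node_point f = wrap (of_nat (3 * cell (Inr e)) + w)"
  then have "Inl f = Inr e"
    using assms node_cell_mem by (intro wrap_on_unique[of _ "offset f" _ w])
      (auto simp: node_point_def)
  then show False by simp
qed

lemma edge_paths_meet:
  assumes e: "e \<in> E" "e' \<in> E" "e \<noteq> e'"
  shows "path_image (edge_path e) \<inter> path_image (edge_path e') \<subseteq>
    node_point ` (edge_nodes e \<inter> edge_nodes e')"
proof clarify
  fix z assume z: "z \<in> path_image (edge_path e)" and z': "z \<in> path_image (edge_path e')"
  note N = edge_nodes_subset[THEN subsetD]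
  show "z \<in> node_point ` (edge_nodes e \<inter> edge_nodes e')"
  proof (rule edge_path_image[OF e(1) z]; rule edge_path_image[OF e(2) z'])
    fix f g assume f: "f \<in> edge_nodes e" "z = node_point f" and g: "g \<in> edge_nodes e'" "z = node_point g"
    then have "f = g" using inj_onD[OF inj_node_point] N e by metis
    then show ?thesis using f g by blast
  next
    fix w w' assume "on (Inr e) w" "z = wrap (of_nat (3 * cell (Inr e)) + w)"
      "on (Inr e') w'" "z = wrap (of_nat (3 * cell (Inr e')) + w')"
    then have "Inr e = (Inr e' :: node + edge)"
      using e by (intro wrap_on_unique[of _ w _ w']) auto
    then show ?thesis using e(3) by simp
  qed (use node_point_not_inside N e in metis)+
qed

lemma gamma_planar: "planar (gamma n)"
proof -
  define \<gamma> where "\<gamma> x = edge_path (the_inv_into E edge_nodes x)" for x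
  have \<gamma>: "\<gamma> (edge_nodes e) = edge_path e" if "e \<in> E" for e
    unfolding \<gamma>_def using the_inv_into_f_f[OF inj_edge_nodes that] by simp
  have nodes_on_path: "path_image (edge_path e) \<inter> node_point ` N = node_point ` edge_nodes e"
    if e: "e \<in> E" for e
  proof
    show "path_image (edge_path e) \<inter> node_point ` N \<subseteq> node_point ` edge_nodes e"
    proof clarify
      fix f assume f: "f \<in> N" and path: "node_point f \<in> path_image (edge_path e)"
      show "node_point f \<in> node_point ` edge_nodes e"
        by (rule edge_path_image[OF e path]) (use node_point_not_inside[OF e f] in auto)
    qed
    have "{pathstart (edge_path e), pathfinish (edge_path e)} \<subseteq> path_image (edge_path e)"
      by (simp add: pathstart_in_path_image pathfinish_in_path_image)
    then show "node_point ` edge_nodes e \<subseteq> path_image (edge_path e) \<inter> node_point ` N"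
      using edge_path_ends[OF e] edge_nodes_subset[OF e] by blast
  qed
  show ?thesis
    unfolding planar_def
  proof (intro exI conjI ballI impI)
    show "inj_on node_point (nodes (gamma n))" by (simp add: gamma_def inj_node_point)
  next
    fix x assume "x \<in> links (gamma n)"
    then obtain e where e: "e \<in> E" "x = edge_nodes e"
      unfolding gamma_def mgraph.simps gamma_edges_eq by (rule imageE)
    show "arc (\<gamma> x)" using e edge_path_arc by (simp only: \<gamma>)
    show "{pathstart (\<gamma> x), pathfinish (\<gamma> x)} = node_point ` ends (gamma n) x"
      using e edge_path_ends by (simp only: \<gamma> gamma_def mgraph.simps)
    show "path_image (\<gamma> x) \<inter> node_point ` nodes (gamma n) = node_point ` ends (gamma n) x"
      using e nodes_on_path by (simp only: \<gamma> gamma_def mgraph.simps)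
    fix x' assume "x' \<in> links (gamma n)" and neq: "x \<noteq> x'"
    then obtain e' where e': "e' \<in> E" "x' = edge_nodes e'"
      unfolding gamma_def mgraph.simps gamma_edges_eq by blast
    have "e \<noteq> e'" using neq e e' by blast
    then show "path_image (\<gamma> x) \<inter> path_image (\<gamma> x') \<subseteq>
        node_point ` (ends (gamma n) x \<inter> ends (gamma n) x')"
      using edge_paths_meet[OF e(1) e'(1)] unfolding e(2) e'(2) \<gamma>[OF e(1)] \<gamma>[OF e'(1)]
      by (simp add: gamma_def)
  qed
qed

end

section \<open>Automorphisms of simplicial surfaces\<close>

context simplicial_surface
begin

lemma inc_types:
  assumes "A \<triangleleft> B"
  shows "A \<in> verts X \<and> B \<in> edges X \<or> A \<in> edges X \<and> B \<in> faces X \<or> A \<in> verts X \<and> B \<in> faces X"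
  using subsetD[OF inc_subset, of "(A, B)"] assms by simp

lemma inc_points: "A \<triangleleft> B \<Longrightarrow> A \<in> points X \<and> B \<in> points X"
  using inc_types[of A B] by (auto simp: points_def)

lemma inc_chain:
  assumes "A \<triangleleft> B" "B \<triangleleft> C"
  shows "A \<in> verts X" "B \<in> edges X" "C \<in> faces X"
proof -
  have "B \<notin> faces X" "B \<notin> verts X"
    using inc_types[OF assms(1)] inc_types[OF assms(2)]
      verts_edges_disjoint verts_faces_disjoint edges_faces_disjoint
    by (auto simp: disjoint_iff)
  then show "A \<in> verts X" "B \<in> edges X" "C \<in> faces X"
    using inc_types[OF assms(1)] inc_types[OF assms(2)] by auto
qed

lemma surface_hom_inc: "\<pi> \<in> surface_hom X X \<Longrightarrow> A \<triangleleft> B \<Longrightarrow> \<pi> A \<triangleleft> \<pi> B"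
  using inc_points[of A B] unfolding surface_hom_def by blast

lemma vert_in_flag:
  assumes "V \<in> verts X"
  obtains e F where "V \<triangleleft> e" "e \<triangleleft> F"
proof -
  have "{F \<in> faces X. V \<triangleleft> F} \<noteq> {}"
    using vert_degree[OF assms] by (metis card.empty not_numeral_le_zero)
  then obtain F where F: "F \<in> faces X" "V \<triangleleft> F" by blast
  have "{e \<in> edges X. e \<triangleleft> F \<and> V \<triangleleft> e} \<noteq> {}"
    using face_vert_edges[OF F(1) assms F(2)] by (metis card.empty zero_neq_numeral)
  then show ?thesis using that by blast
qed

text \<open>A vertex is the bottom of a chain of two incidences, and homomorphisms preserve such chains.\<close>

lemma surface_hom_verts:
  assumes "\<pi> \<in> surface_hom X X" "V \<in> verts X"
  shows "\<pi> V \<in> verts X"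
proof -
  obtain e F where eF: "V \<triangleleft> e" "e \<triangleleft> F" using vert_in_flag[OF assms(2)] .
  then have "\<pi> V \<triangleleft> \<pi> e" "\<pi> e \<triangleleft> \<pi> F"
    using surface_hom_inc[OF assms(1)] by simp_all
  then show ?thesis by (rule inc_chain(1))
qed

lemma face_boundary_eq: "F \<in> faces X \<Longrightarrow> face_boundary X F = {A. A \<triangleleft> F}"
  using inc_types[of _ F] edges_faces_disjoint verts_faces_disjoint
  by (auto simp: face_boundary_def disjoint_iff)

text \<open>
  The boundary of a face consists of all points below it, so a bijection that preserves and reflects
  incidence is automatically an isomorphism on the boundaries.
\<close>

lemma incidence_bijection_hom:
  assumes bij: "bij_betw f (points X) (points X)"
    and iff: "\<And>A B. A \<in> points X \<Longrightarrow> B \<in> points X \<Longrightarrow> f A \<triangleleft> f B \<longleftrightarrow> A \<triangleleft> B"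
    and faces: "\<And>F. F \<in> faces X \<Longrightarrow> f F \<in> faces X"
  shows "f \<in> surface_hom X X"
proof -
  have boundary: "bij_betw f (face_boundary X F) (face_boundary X (f F))" if F: "F \<in> faces X" for F
  proof -
    have Fp: "F \<in> points X" using F by (simp add: points_def)
    have "inj_on f {A. A \<triangleleft> F}"
      using bij inc_points by (auto simp: bij_betw_def inj_on_def)
    moreover have "f ` {A. A \<triangleleft> F} = {A. A \<triangleleft> f F}"
    proof
      show "f ` {A. A \<triangleleft> F} \<subseteq> {A. A \<triangleleft> f F}" using iff[OF _ Fp] inc_points by blast
      show "{A. A \<triangleleft> f F} \<subseteq> f ` {A. A \<triangleleft> F}"
      proof clarify
        fix A assume A: "A \<triangleleft> f F"
        then have "A \<in> f ` points X" using inc_points bij by (simp add: bij_betw_def)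
        then show "A \<in> f ` {A. A \<triangleleft> F}" using A iff[OF _ Fp] by blast
      qed
    qed
    ultimately show ?thesis using F faces by (simp add: face_boundary_eq bij_betw_def)
  qed
  have P: "A \<in> points X" if "A \<in> face_boundary X F" for A F
    using that by (auto simp: face_boundary_def points_def)
  show ?thesis
    unfolding surface_hom_def mem_Collect_eq
  proof (intro conjI ballI impI)
    show "f \<in> points X \<rightarrow> points X" using bij by (auto dest: bij_betwE)
  next
    fix A B assume "A \<in> points X" "B \<in> points X" "A \<triangleleft> B"
    then show "f A \<triangleleft> f B" using iff by blast
  next
    fix F A B assume "A \<in> face_boundary X F" "B \<in> face_boundary X F"
    then show "A \<triangleleft> B \<longleftrightarrow> f A \<triangleleft> f B" by (intro iff[symmetric] P)
  qed (rule boundary)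
qed

lemma incidence_bijection_aut:
  assumes Bij: "f \<in> Bij (points X)"
    and iff: "\<And>A B. A \<in> points X \<Longrightarrow> B \<in> points X \<Longrightarrow> f A \<triangleleft> f B \<longleftrightarrow> A \<triangleleft> B"
    and faces: "\<And>F. F \<in> points X \<Longrightarrow> F \<in> faces X \<longleftrightarrow> f F \<in> faces X"
  shows "f \<in> surface_auts X"
proof -
  let ?g = "inv_into (points X) f"
  have bij: "bij_betw f (points X) (points X)" using Bij by (simp add: Bij_def)
  then have bij_g: "bij_betw ?g (points X) (points X)" by (rule bij_betw_inv_into)
  have g: "?g A \<in> points X" "f (?g A) = A" if "A \<in> points X" for A
    using that bij bij_g by (auto simp: bij_betw_inv_into_right dest: bij_betwE)
  have "f \<in> surface_hom X X"
    using bij iff faces by (intro incidence_bijection_hom) (auto simp: points_def)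
  moreover have "?g \<in> surface_hom X X"
  proof (rule incidence_bijection_hom[OF bij_g])
    show "?g A \<triangleleft> ?g B \<longleftrightarrow> A \<triangleleft> B" if "A \<in> points X" "B \<in> points X" for A B
      using iff[of "?g A" "?g B"] g that by simp
    show "?g F \<in> faces X" if "F \<in> faces X" for F
      using faces[of "?g F"] g[of F] that by (simp add: points_def)
  qed
  ultimately show ?thesis using Bij by (simp add: surface_auts_def)
qed

lemma aut_bij: "\<pi> \<in> surface_auts X \<Longrightarrow> bij_betw \<pi> (points X) (points X)"
  by (simp add: surface_auts_def Bij_def)

lemma aut_inv:
  assumes "\<pi> \<in> surface_auts X" "A \<in> points X"
  shows "inv_into (points X) \<pi> A \<in> points X" "\<pi> (inv_into (points X) \<pi> A) = A"
    "inv_into (points X) \<pi> (\<pi> A) = A" "\<pi> A \<in> points X"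
proof -
  note bij = aut_bij[OF assms(1)]
  show "inv_into (points X) \<pi> A \<in> points X"
    using bij_betw_inv_into[OF bij] assms(2) by (rule bij_betwE[THEN bspec])
  show "\<pi> A \<in> points X"
    using bij assms(2) by (rule bij_betwE[THEN bspec])
  show "\<pi> (inv_into (points X) \<pi> A) = A" "inv_into (points X) \<pi> (\<pi> A) = A"
    using bij assms(2) by (simp_all add: bij_betw_inv_into_right bij_betw_inv_into_left)
qed

lemma aut_inc_iff:
  assumes "\<pi> \<in> surface_auts X" "A \<in> points X" "B \<in> points X"
  shows "\<pi> A \<triangleleft> \<pi> B \<longleftrightarrow> A \<triangleleft> B"
proof
  assume "\<pi> A \<triangleleft> \<pi> B"
  then have "inv_into (points X) \<pi> (\<pi> A) \<triangleleft> inv_into (points X) \<pi> (\<pi> B)"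
    using assms(1) surface_hom_inc by (simp add: surface_auts_def)
  then show "A \<triangleleft> B" using aut_inv(3)[OF assms(1)] assms(2,3) by simp
qed (use assms(1) surface_hom_inc in \<open>simp add: surface_auts_def\<close>)

lemma aut_verts_eq: "\<pi> \<in> surface_auts X \<Longrightarrow> \<pi> ` verts X = verts X"
proof
  assume \<pi>: "\<pi> \<in> surface_auts X"
  then show "\<pi> ` verts X \<subseteq> verts X"
    using surface_hom_verts by (auto simp: surface_auts_def)
  show "verts X \<subseteq> \<pi> ` verts X"
  proof
    fix V assume V: "V \<in> verts X"
    then have "inv_into (points X) \<pi> V \<in> verts X"
      using \<pi> surface_hom_verts by (auto simp: surface_auts_def)
    moreover have "\<pi> (inv_into (points X) \<pi> V) = V"
      using V \<pi> by (intro aut_inv(2)) (auto simp: points_def)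
    ultimately show "V \<in> \<pi> ` verts X" by (metis imageI)
  qed
qed

lemma aut_faces_eq: "\<pi> \<in> surface_auts X \<Longrightarrow> \<pi> ` faces X = faces X"
proof
  assume \<pi>: "\<pi> \<in> surface_auts X"
  then show "\<pi> ` faces X \<subseteq> faces X"
    using surface_hom_faces by (auto simp: surface_auts_def)
  show "faces X \<subseteq> \<pi> ` faces X"
  proof
    fix F assume F: "F \<in> faces X"
    then have "inv_into (points X) \<pi> F \<in> faces X"
      using \<pi> surface_hom_faces by (auto simp: surface_auts_def)
    moreover have "\<pi> (inv_into (points X) \<pi> F) = F"
      using F \<pi> by (intro aut_inv(2)) (auto simp: points_def)
    ultimately show "F \<in> \<pi> ` faces X" by (metis imageI)
  qed
qed

lemma aut_degree:
  assumes \<pi>: "\<pi> \<in> surface_auts X" and V: "V \<in> verts X"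
  shows "card {F \<in> faces X. \<pi> V \<triangleleft> F} = card {F \<in> faces X. V \<triangleleft> F}"
proof -
  have "\<pi> V \<triangleleft> \<pi> F \<longleftrightarrow> V \<triangleleft> F" if "F \<in> faces X" for F
    using aut_inc_iff[OF \<pi>] V that by (simp add: points_def)
  then have "{F \<in> faces X. \<pi> V \<triangleleft> F} = \<pi> ` {F \<in> faces X. V \<triangleleft> F}"
    by (subst aut_faces_eq[OF \<pi>, symmetric]) blast
  moreover have "inj_on \<pi> {F \<in> faces X. V \<triangleleft> F}"
    using aut_bij[OF \<pi>] by (auto simp: bij_betw_def points_def intro: inj_on_subset)
  ultimately show ?thesis by (simp add: card_image)
qed

text \<open>In a vertex-faithful surface every point is determined by its vertices.\<close>

lemma aut_eqI:
  assumes faithful: "vertex_faithful X"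
    and \<pi>: "\<pi> \<in> surface_auts X" and \<rho>: "\<rho> \<in> surface_auts X"
    and eq: "\<And>V. V \<in> verts X \<Longrightarrow> \<pi> V = \<rho> V"
  shows "\<pi> = \<rho>"
proof -
  let ?T = "\<lambda>x. {V \<in> verts X. V \<triangleleft> x \<or> V = x}"
  have T: "?T (\<sigma> x) = \<sigma> ` ?T x" if \<sigma>: "\<sigma> \<in> surface_auts X" and x: "x \<in> points X" for \<sigma> x
  proof -
    have "\<sigma> V \<triangleleft> \<sigma> x \<longleftrightarrow> V \<triangleleft> x" "\<sigma> V = \<sigma> x \<longleftrightarrow> V = x" if "V \<in> verts X" for V
      using aut_inc_iff[OF \<sigma>] aut_bij[OF \<sigma>] x that
      by (auto simp: points_def bij_betw_def inj_on_def)
    then show ?thesis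
      by (subst aut_verts_eq[OF \<sigma>, symmetric]) blast
  qed
  have "\<pi> x = \<rho> x" if x: "x \<in> points X" for x
  proof -
    have "?T (\<pi> x) = ?T (\<rho> x)"
      unfolding T[OF \<pi> x] T[OF \<rho> x] using eq by (intro image_cong) auto
    then show ?thesis
      using faithful aut_inv(4)[OF \<pi> x] aut_inv(4)[OF \<rho> x]
      by (auto simp: vertex_faithful_def inj_on_def)
  qed
  then show ?thesis
    using \<pi> \<rho> by (intro extensionalityI[of _ "points X"]) (auto simp: surface_auts_def Bij_def)
qed

end

section \<open>The surface is a vertex-faithful sphere\<close>

text \<open>
  Vertices, edges and faces of the surface have to live in one type, so its points are coded by an
  arbitrary injection of the disjoint union \<^typ>\<open>point\<close>.
\<close>

locale gamma_surface = cyclic_index +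
  fixes h :: "point \<Rightarrow> 'a"
  assumes inj_h: "inj h"
begin

fun below :: "point \<Rightarrow> point \<Rightarrow> bool" where
  "below (Vert v) (Edge e) \<longleftrightarrow> e \<in> E \<and> v \<in> edge_verts e"
| "below (Edge e) (Face f) \<longleftrightarrow> e \<in> E \<and> f \<in> edge_nodes e"
| "below (Vert v) (Face f) \<longleftrightarrow> f \<in> N \<and> v \<in> corners f"
| "below _ _ \<longleftrightarrow> False"

definition XC :: "'a surface" where
  "XC = \<lparr>verts = h ` Vert ` V, edges = h ` Edge ` E, faces = h ` Face ` N,
     inc = (\<lambda>x y. \<exists>p q. x = h p \<and> y = h q \<and> below p q)\<rparr>"

lemma h_eq [simp]: "h p = h q \<longleftrightarrow> p = q"
  using inj_h by (simp add: inj_eq)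

lemma XC_sel: "verts XC = h ` Vert ` V" "edges XC = h ` Edge ` E" "faces XC = h ` Face ` N"
  by (simp_all add: XC_def)

lemma inc_h [simp]: "inc XC (h p) (h q) \<longleftrightarrow> below p q"
  by (simp add: XC_def)

lemma below_cases:
  assumes "below p q"
  obtains v e where "p = Vert v" "q = Edge e" "v \<in> V" "e \<in> E" "v \<in> edge_verts e"
  | e f where "p = Edge e" "q = Face f" "e \<in> E" "f \<in> N" "f \<in> edge_nodes e"
  | v f where "p = Vert v" "q = Face f" "v \<in> V" "f \<in> N" "v \<in> corners f"
  using assms edge_verts_subset edge_nodes_subset corners_subset
  by (cases "(p, q)" rule: below.cases) (simp; blast)+

lemma edge_verts_XC: "e \<in> E \<Longrightarrow> {x \<in> verts XC. inc XC x (h (Edge e))} = h ` Vert ` edge_verts e"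
  using edge_verts_subset[of e] by (auto simp: XC_sel)

lemma face_edges_XC: "f \<in> N \<Longrightarrow> {x \<in> edges XC. inc XC x (h (Face f))} = h ` Edge ` node_edges f"
  using node_edges_iff[of f] by (auto simp: XC_sel)

lemma face_verts_XC: "f \<in> N \<Longrightarrow> {x \<in> verts XC. inc XC x (h (Face f))} = h ` Vert ` corners f"
  using corners_subset[of f] by (auto simp: XC_sel)

lemma face_vert_edges_XC:
  "f \<in> N \<Longrightarrow> {x \<in> edges XC. inc XC x (h (Face f)) \<and> inc XC (h (Vert v)) x} =
    h ` Edge ` {e \<in> node_edges f. v \<in> edge_verts e}"
  using node_edges_iff[of f] by (auto simp: XC_sel)

lemma edge_faces_XC: "e \<in> E \<Longrightarrow> {x \<in> faces XC. inc XC (h (Edge e)) x} = h ` Face ` edge_nodes e"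
  using edge_nodes_subset[of e] by (auto simp: XC_sel)

lemma vert_faces_XC:
  "v \<in> V \<Longrightarrow> {x \<in> faces XC. inc XC (h (Vert v)) x} = h ` Face ` set (ring v)"
  using set_ring[of v] by (auto simp: XC_sel)

lemma card_h_image:
  "card (h ` Vert ` A) = card A" "card (h ` Edge ` B) = card B" "card (h ` Face ` C) = card C"
  by (simp_all add: image_image card_image inj_on_def)

lemma umbrella_ring:
  assumes "v \<in> V"
  shows "umbrella XC (h (Vert v)) (map (h \<circ> Face) (ring v))"
proof -
  have "\<exists>x \<in> edges XC. inc XC (h (Vert v)) x \<and> inc XC x (map (h \<circ> Face) (ring v) ! m) \<and>
      inc XC x (map (h \<circ> Face) (ring v) ! (Suc m mod length (ring v)))"
    if m: "m < length (ring v)" for m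
  proof -
    obtain e where "e \<in> E" "v \<in> edge_verts e" "ring v ! m \<in> edge_nodes e"
      "ring v ! (Suc m mod length (ring v)) \<in> edge_nodes e"
      using ring_consecutive[OF assms m] by blast
    moreover have "Suc m mod length (ring v) < length (ring v)"
      using m by (intro mod_less_divisor) linarith
    ultimately show ?thesis using m by (intro bexI[of _ "h (Edge e)"]) (auto simp: XC_sel)
  qed
  moreover have "distinct (map (h \<circ> Face) (ring v))"
    using distinct_ring[OF assms] by (simp add: distinct_map inj_on_def)
  ultimately show ?thesis
    unfolding umbrella_def vert_faces_XC[OF assms] by (simp add: image_image)
qed

lemma degree_XC: "v \<in> V \<Longrightarrow> card {x \<in> faces XC. inc XC (h (Vert v)) x} = length (ring v)"
  by (simp add: vert_faces_XC card_h_image distinct_card distinct_ring)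

lemma finite_points: "finite (points XC)"
  using finite_V finite_E finite_N unfolding points_def XC_sel by blast

lemma XC_surface: "simplicial_surface XC"
proof
  show "countable (points XC)" using finite_points by (rule countable_finite)
  have "1 \<in> I" using n_gt_2 by simp
  then have "Outer \<in> V" "(eAB, 1) \<in> E" "An 1 \<in> N" by auto
  then show "verts XC \<noteq> {}" "edges XC \<noteq> {}" "faces XC \<noteq> {}"
    unfolding XC_sel by blast+
  show "verts XC \<inter> edges XC = {}" "verts XC \<inter> faces XC = {}" "edges XC \<inter> faces XC = {}"
    by (auto simp: XC_sel)
  show "{(A, B). inc XC A B} \<subseteq>
      verts XC \<times> edges XC \<union> edges XC \<times> faces XC \<union> verts XC \<times> faces XC"
  proof clarify
    fix A B assume AB: "inc XC A B"
      "\<not> (A \<in> verts XC \<and> B \<in> faces XC)" "\<not> (A \<in> edges XC \<and> B \<in> faces XC)"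
    then obtain p q where "A = h p" "B = h q" "below p q" by (auto simp: XC_def)
    with AB show "A \<in> verts XC \<and> B \<in> edges XC"
      by (auto simp: XC_sel elim: below_cases)
  qed
next
  fix x assume "x \<in> edges XC"
  then obtain e where e: "e \<in> E" "x = h (Edge e)" by (auto simp: XC_sel)
  then show "card {V \<in> verts XC. inc XC V x} = 2" "card {F \<in> faces XC. inc XC x F} = 2"
    using edge_verts_XC edge_faces_XC card_edge_verts card_edge_nodes card_h_image by simp_all
next
  fix x assume "x \<in> faces XC"
  then obtain f where f: "f \<in> N" "x = h (Face f)" by (auto simp: XC_sel)
  then show "card {e \<in> edges XC. inc XC e x} = 3" "card {V \<in> verts XC. inc XC V x} = 3"
    using face_edges_XC face_verts_XC card_node_edges card_corners card_h_image by simp_all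
  fix y assume "y \<in> verts XC" "inc XC y x"
  then obtain v where "y = h (Vert v)" "v \<in> corners f" using f by (auto simp: XC_sel)
  then show "card {e \<in> edges XC. inc XC e x \<and> inc XC y e} = 2"
    using f face_vert_edges_XC card_node_edges_at card_h_image by simp
next
  fix x assume "x \<in> verts XC"
  then obtain v where v: "v \<in> V" "x = h (Vert v)" by (auto simp: XC_sel)
  have "3 \<le> length (ring v)"
    using n_gt_2 length_ring[of v] by (auto split: vert.splits)
  then show "finite {F \<in> faces XC. inc XC x F} \<and> 3 \<le> card {F \<in> faces XC. inc XC x F}"
    using v vert_faces_XC degree_XC by simp
  show "\<exists>Fs. umbrella XC x Fs" using umbrella_ring v by blast
qed

sublocale simplicial_surface XC by (rule XC_surface)

fun span :: "point \<Rightarrow> vert set" where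
  "span (Vert v) = {v}"
| "span (Edge e) = edge_verts e"
| "span (Face f) = corners f"

text \<open>Points of different dimension have different numbers of vertices.\<close>

lemma inj_span: "inj_on span (Vert ` V \<union> Edge ` E \<union> Face ` N)"
proof (rule inj_onI)
  fix p q assume p: "p \<in> Vert ` V \<union> Edge ` E \<union> Face ` N" and q: "q \<in> Vert ` V \<union> Edge ` E \<union> Face ` N"
    and eq: "span p = span q"
  have card: "card (span r) = (case r of Vert _ \<Rightarrow> 1 | Edge _ \<Rightarrow> 2 | Face _ \<Rightarrow> 3)"
    if "r \<in> Vert ` V \<union> Edge ` E \<union> Face ` N" for r
    using that card_edge_verts card_corners by (cases r) auto
  then have "(case p of Vert _ \<Rightarrow> 1 | Edge _ \<Rightarrow> 2 | Face _ \<Rightarrow> 3) =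
      (case q of Vert _ \<Rightarrow> 1 | Edge _ \<Rightarrow> 2 | Face _ \<Rightarrow> (3 :: nat))"
    using p q eq by metis
  then consider v w where "p = Vert v" "q = Vert w" | e e' where "p = Edge e" "q = Edge e'"
    | f f' where "p = Face f" "q = Face f'"
    by (cases p; cases q) auto
  then show "p = q"
  proof cases
    case 1 then show ?thesis using eq by simp
  next
    case 2 then show ?thesis using p q eq inj_edge_verts by (auto dest: inj_onD)
  next
    case 3 then show ?thesis using p q eq inj_corners by (auto dest: inj_onD)
  qed
qed

lemma XC_vertex_faithful: "vertex_faithful XC"
  unfolding vertex_faithful_def
proof (rule inj_onI)
  let ?T = "\<lambda>x. {V \<in> verts XC. inc XC V x \<or> V = x}"
  let ?P = "Vert ` V \<union> Edge ` E \<union> Face ` N"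
  have T: "?T (h p) = h ` Vert ` span p" if "p \<in> ?P" for p
    using that edge_verts_subset corners_subset by (cases p) (force simp: XC_sel)+
  fix x y assume "x \<in> points XC" "y \<in> points XC" and eq: "?T x = ?T y"
  then obtain p q where pq: "x = h p" "y = h q" "p \<in> ?P" "q \<in> ?P"
    unfolding points_def XC_sel by blast
  have "h ` Vert ` span p = h ` Vert ` span q"
    using eq T pq by simp
  then have "span p = span q"
    by (simp add: inj_image_eq_iff inj_h inj_def)
  then show "x = y" using inj_span pq by (auto dest: inj_onD)
qed

text \<open>Every point is only a few incidences away from \<open>Outer\<close>, so no walk around the ring is needed.\<close>

lemma XC_connected: "connected_surface XC"
proof -
  let ?r = "{(C, D). inc XC C D \<or> inc XC D C}\<^sup>*"
  have sym: "sym ?r" by (intro sym_rtrancl symI) auto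
  have step: "(h p, h q) \<in> ?r" if "below p q \<or> below q p" for p q
    using that by (intro r_into_rtrancl) auto
  have one: "1 \<in> I" using n_gt_2 by simp
  note trans' = rtrancl_trans[of _ _ "{(C, D). inc XC C D \<or> inc XC D C}"]
  have corner: "(h (Vert v), h (Vert w)) \<in> ?r" if "f \<in> N" "v \<in> corners f" "w \<in> corners f" for f v w
    using step[of "Vert v" "Face f"] step[of "Face f" "Vert w"] that by (auto intro: trans')
  have hept: "(h (Vert (Hept i)), h (Vert Outer)) \<in> ?r" if "i \<in> I" for i
    using corner[of "Bn i"] that by simp
  have vert: "(h (Vert v), h (Vert Outer)) \<in> ?r" if "v \<in> V" for v
  proof (cases v)
    case Inner
    then show ?thesis
      using trans'[OF corner[of "Dn 1" Inner "Hept 1"] hept[OF one]] one by simp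
  qed (use that corner[of "An i" for i] hept in auto)
  have face: "(h (Face f), h (Vert Outer)) \<in> ?r" if "f \<in> N" for f
  proof -
    have "corners f \<noteq> {}" by (cases f) auto
    then obtain v where "v \<in> corners f" by blast
    then show ?thesis
      using step[of "Face f" "Vert v"] vert[of v] corners_subset that by (auto intro: trans')
  qed
  have edge: "(h (Edge e), h (Vert Outer)) \<in> ?r" if "e \<in> E" for e
  proof -
    have "edge_nodes e \<noteq> {}" by (cases e rule: edge_nodes.cases) auto
    then obtain f where "f \<in> edge_nodes e" by blast
    then show ?thesis
      using step[of "Edge e" "Face f"] face[of f] edge_nodes_subset[OF that] that
      by (auto intro: trans')
  qed
  have all: "(A, h (Vert Outer)) \<in> ?r" if "A \<in> points XC" for A
    using that vert edge face unfolding points_def XC_sel by blast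
  show ?thesis
    unfolding connected_surface_def by (intro ballI trans'[OF all symD[OF sym all]])
qed

lemma XC_sphere: "simplicial_sphere XC"
  using XC_surface XC_connected finite_points
  by (simp add: simplicial_sphere_def euler_char_def XC_sel card_h_image card_V card_E card_N del: One_nat_def)

lemma XC_face_graph: "graph_iso (face_graph XC) (gamma n)"
proof -
  define \<phi> where "\<phi> x = (THE f. x = h (Face f))" for x
  define \<psi> where "\<psi> x = edge_nodes (THE e. x = h (Edge e))" for x
  have [simp]: "\<phi> (h (Face f)) = f" "\<psi> (h (Edge e)) = edge_nodes e" for f e
    by (simp_all add: \<phi>_def \<psi>_def)
  have "bij_betw \<phi> (faces XC) N"
    by (auto simp: bij_betw_def inj_on_def XC_sel image_image)
  moreover have "bij_betw \<psi> (edges XC) (gamma_edges n)"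
    unfolding bij_betw_def gamma_edges_eq XC_sel image_image
    by (intro conjI inj_on_imageI) (simp_all add: comp_def inj_edge_nodes image_image del: One_nat_def)
  moreover have "\<psi> x = \<phi> ` {F \<in> faces XC. inc XC x F}" if x: "x \<in> edges XC" for x
  proof -
    obtain e where e: "e \<in> E" "x = h (Edge e)" using x by (auto simp: XC_sel)
    then show ?thesis by (simp only: edge_faces_XC) (simp add: image_image)
  qed
  ultimately show ?thesis
    unfolding graph_iso_def face_graph_def gamma_def by (intro exI[of _ \<phi>] exI[of _ \<psi>]) simp
qed

end

section \<open>The automorphism group\<close>

context gamma_surface
begin

abbreviation P :: "point set" where "P \<equiv> Vert ` V \<union> Edge ` E \<union> Face ` N"

lemma points_XC: "points XC = h ` P"
  by (simp only: points_def XC_sel image_Un)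

fun turn_vert :: "int \<Rightarrow> vert \<Rightarrow> vert" where
  "turn_vert k Outer = Outer"
| "turn_vert k Inner = Inner"
| "turn_vert k (Tri i) = Tri (shift k i)"
| "turn_vert k (Quad i) = Quad (shift k i)"
| "turn_vert k (Hept i) = Hept (shift k i)"

fun turn_node :: "int \<Rightarrow> node \<Rightarrow> node" where
  "turn_node k (An i) = An (shift k i)"
| "turn_node k (Bn i) = Bn (shift k i)"
| "turn_node k (Cn i) = Cn (shift k i)"
| "turn_node k (Dn i) = Dn (shift k i)"
| "turn_node k (En i) = En (shift k i)"
| "turn_node k (Fn i) = Fn (shift k i)"

fun turn :: "int \<Rightarrow> point \<Rightarrow> point" where
  "turn k (Vert v) = Vert (turn_vert k v)"
| "turn k (Edge e) = Edge (fst e, shift k (snd e))"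
| "turn k (Face f) = Face (turn_node k f)"

lemma turn_vert_turn_vert: "turn_vert a (turn_vert b v) = turn_vert (a + b) v"
  by (cases v) (simp_all add: shift_shift)

lemma turn_turn: "turn a (turn b p) = turn (a + b) p"
proof (cases p)
  case (Face f)
  then show ?thesis by (cases f) (simp_all add: shift_shift)
qed (simp_all add: shift_shift turn_vert_turn_vert)

lemma turn_vert_0: "v \<in> V \<Longrightarrow> turn_vert 0 v = v"
  by (cases v) (simp_all add: shift_0)

lemma turn_0:
  assumes "p \<in> P"
  shows "turn 0 p = p"
proof (cases p)
  case (Face f)
  then show ?thesis using assms by (cases f) (auto simp: shift_0)
qed (use assms in \<open>auto simp: turn_vert_0 shift_0\<close>)

lemma turn_mod: "turn (k mod int n) p = turn k p"
proof (cases p)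
  case (Face f)
  then show ?thesis by (cases f) (simp_all add: shift_mod)
next
  case (Vert v)
  then show ?thesis by (cases v) (simp_all add: shift_mod)
qed (simp add: shift_mod)

lemma turn_vert_mem: "v \<in> V \<Longrightarrow> turn_vert k v \<in> V"
  by (cases v) simp_all

lemma turn_node_mem: "turn_node k f \<in> N"
  by (cases f) simp_all

lemma turn_mem: "p \<in> P \<Longrightarrow> turn k p \<in> P"
  using turn_vert_mem turn_node_mem shift_mem by auto

lemma edge_verts_turn: "v \<in> edge_verts e \<Longrightarrow> turn_vert k v \<in> edge_verts (fst e, shift k (snd e))"
  by (cases e rule: edge_verts.cases) (auto simp: shift_shift add.commute)

lemma edge_nodes_turn: "f \<in> edge_nodes e \<Longrightarrow> turn_node k f \<in> edge_nodes (fst e, shift k (snd e))"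
  by (cases e rule: edge_nodes.cases) (auto simp: shift_shift add.commute)

lemma corners_turn: "v \<in> corners f \<Longrightarrow> turn_vert k v \<in> corners (turn_node k f)"
  by (cases f) (auto simp: shift_shift add.commute)

lemma below_turn_mono: "below p q \<Longrightarrow> below (turn k p) (turn k q)"
  using edge_verts_turn edge_nodes_turn corners_turn turn_node_mem shift_mem
  by (cases "(p, q)" rule: below.cases) auto

lemma below_turn:
  assumes "p \<in> P" "q \<in> P"
  shows "below (turn k p) (turn k q) \<longleftrightarrow> below p q"
  using below_turn_mono[of p q k] below_turn_mono[of "turn k p" "turn k q" "-k"] assms
  by (auto simp only: turn_turn add.left_inverse turn_0)

definition rot :: "int \<Rightarrow> 'a \<Rightarrow> 'a" where
  "rot k = restrict (\<lambda>x. h (turn k (inv_into UNIV h x))) (points XC)"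

lemma rot_h: "p \<in> P \<Longrightarrow> rot k (h p) = h (turn k p)"
  by (simp add: rot_def points_XC inj_h inv_f_f)

lemma rot_aut: "rot k \<in> surface_auts XC"
proof (rule incidence_bijection_aut)
  have P: "turn k p \<in> P" if "p \<in> P" for k p using turn_mem that .
  have "rot k (rot (-k) x) = x \<and> rot (-k) (rot k x) = x \<and> rot k x \<in> points XC \<and> rot (-k) x \<in> points XC"
    if x: "x \<in> points XC" for x
  proof -
    obtain p where p: "p \<in> P" "x = h p" using x unfolding points_XC by blast
    show ?thesis
      unfolding p(2) rot_h[OF p(1)] rot_h[OF P[OF p(1)]] turn_turn points_XC
      using p(1) P by (simp add: turn_0)
  qed
  then have "bij_betw (rot k) (points XC) (points XC)"
    by (intro bij_betwI[where g = "rot (-k)"]) auto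
  then show "rot k \<in> Bij (points XC)" by (simp add: Bij_def rot_def)
next
  fix x y assume "x \<in> points XC" "y \<in> points XC"
  then obtain p q where pq: "p \<in> P" "x = h p" "q \<in> P" "y = h q" unfolding points_XC by blast
  then show "inc XC (rot k x) (rot k y) \<longleftrightarrow> inc XC x y"
    by (simp only: rot_h inc_h below_turn)
next
  fix x assume "x \<in> points XC"
  then obtain p where p: "p \<in> P" "x = h p" unfolding points_XC by blast
  show "x \<in> faces XC \<longleftrightarrow> rot k x \<in> faces XC"
    unfolding p(2) rot_h[OF p(1)] using p(1) turn_node_mem by (cases p) (auto simp: XC_sel)
qed

lemma rot_compose: "compose (points XC) (rot a) (rot b) = rot (a + b)"
proof (rule extensionalityI[of _ "points XC"])
  fix x assume x: "x \<in> points XC"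
  then obtain p where p: "p \<in> P" "x = h p" unfolding points_XC by blast
  show "compose (points XC) (rot a) (rot b) x = rot (a + b) x"
    using x unfolding p(2) compose_eq[OF x[unfolded p(2)]]
    by (simp only: rot_h[OF p(1)] rot_h[OF turn_mem[OF p(1)]] turn_turn)
qed (simp_all add: rot_def)

lemma rot_eq_iff: "rot a = rot b \<longleftrightarrow> a mod int n = b mod int n"
proof
  have "Vert (Tri 1) \<in> P" using n_gt_2 by simp
  then have "rot k (h (Vert (Tri 1))) = h (Vert (Tri (shift k 1)))" for k
    by (simp only: rot_h turn.simps turn_vert.simps)
  moreover assume "rot a = rot b"
  ultimately have "shift a 1 = shift b 1" by (metis h_eq point.inject(1) vert.inject(1))
  then show "a mod int n = b mod int n" by (simp only: shift_one_eq_iff)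
next
  assume "a mod int n = b mod int n"
  then have "turn a = turn b" by (metis turn_mod ext)
  then show "rot a = rot b" by (simp add: rot_def)
qed

definition around :: "vert \<Rightarrow> vert \<Rightarrow> vert \<Rightarrow> bool" where
  "around u v w \<longleftrightarrow> (\<exists>f \<in> N. {u, v, w} \<subseteq> corners f)"

lemma around_outer:
  "i \<in> I \<Longrightarrow> around Outer (Tri i) (Quad i)"
  "i \<in> I \<Longrightarrow> around Outer (Quad i) (Hept (nx i))"
  "i \<in> I \<Longrightarrow> around Outer (Hept i) (Tri i)"
proof -
  assume i: "i \<in> I"
  show "around Outer (Tri i) (Quad i)"
    unfolding around_def using i by (intro bexI[of _ "An i"]) auto
  show "around Outer (Quad i) (Hept (nx i))"
    unfolding around_def using i by (intro bexI[of _ "En i"]) auto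
  show "around Outer (Hept i) (Tri i)"
    unfolding around_def using i by (intro bexI[of _ "Bn i"]) auto
qed

text \<open>
  Each of the vertices \<open>Tri i\<close>, \<open>Quad i\<close>, \<open>Hept (nx i)\<close>, \<open>Tri (nx i)\<close>, \<dots> around \<open>Outer\<close> is determined
  by its predecessor and its own type.
\<close>

lemma around_outer_unique:
  "around Outer (Tri i) (Quad j) \<Longrightarrow> j = i"
  "around Outer (Quad i) (Hept j) \<Longrightarrow> j = nx i"
  "around Outer (Hept i) (Tri j) \<Longrightarrow> j = i"
  "\<not> around Outer Inner v"
proof -
  have *: "(j = i \<or> \<not> {Outer, Tri i, Quad j} \<subseteq> corners f) \<and>
      (j = nx i \<or> \<not> {Outer, Quad i, Hept j} \<subseteq> corners f) \<and>
      (j = i \<or> \<not> {Outer, Hept i, Tri j} \<subseteq> corners f) \<and>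
      \<not> {Outer, Inner, v} \<subseteq> corners f" for f
    by (cases f) auto
  show "around Outer (Tri i) (Quad j) \<Longrightarrow> j = i" "around Outer (Quad i) (Hept j) \<Longrightarrow> j = nx i"
    "around Outer (Hept i) (Tri j) \<Longrightarrow> j = i" "\<not> around Outer Inner v"
    unfolding around_def using * by blast+
qed

text \<open>
  \<open>Outer\<close> is the only vertex of degree \<open>3 * n\<close>, so it is fixed by every automorphism. Its
  neighbours, read along the umbrella, have degrees \<open>3, 4, 7, 3, 4, 7, \<dots>\<close>. This pattern has a
  sense of direction, which excludes reflections, and an automorphism rotates it by the amount by
  which it moves \<open>Tri 1\<close>. Even if \<open>n\<close> is \<open>3\<close>, \<open>4\<close> or \<open>7\<close> the vertex \<open>Inner\<close> cannot be confused
  with one of these neighbours, because it has no face in common with \<open>Outer\<close>.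
\<close>

lemma aut_is_rot:
  assumes \<pi>: "\<pi> \<in> surface_auts XC"
  shows "\<exists>k. \<pi> = rot k"
proof -
  have "\<exists>w \<in> V. \<pi> (h (Vert v)) = h (Vert w)" if "v \<in> V" for v
    using aut_verts_eq[OF \<pi>] that unfolding XC_sel by blast
  then obtain \<sigma> where \<sigma>: "\<And>v. v \<in> V \<Longrightarrow> \<sigma> v \<in> V" "\<And>v. v \<in> V \<Longrightarrow> \<pi> (h (Vert v)) = h (Vert (\<sigma> v))"
    by metis
  have vert_point: "h (Vert v) \<in> points XC" "h (Vert v) \<in> verts XC" if "v \<in> V" for v
    using that by (auto simp: points_XC XC_sel)
  have deg: "length (ring (\<sigma> v)) = length (ring v)" if "v \<in> V" for v
    using aut_degree[OF \<pi> vert_point(2)[OF that]] \<sigma>(2)[OF that] degree_XC \<sigma>(1) that by simp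
  have \<sigma>_eq: "v = w" if "v \<in> V" "w \<in> V" "\<sigma> v = \<sigma> w" for v w
  proof -
    have "\<pi> (h (Vert v)) = \<pi> (h (Vert w))" using that \<sigma>(2) by simp
    then have "h (Vert v) = h (Vert w)"
      using aut_bij[OF \<pi>] vert_point that by (auto simp: bij_betw_def dest: inj_onD)
    then show ?thesis by simp
  qed
  have around: "around (\<sigma> u) (\<sigma> v) (\<sigma> w)" if uvw: "around u v w" for u v w
  proof -
    obtain f where f: "f \<in> N" "{u, v, w} \<subseteq> corners f" using uvw by (auto simp: around_def)
    then have "\<pi> (h (Face f)) \<in> \<pi> ` faces XC" by (auto simp: XC_sel)
    then obtain g where g: "g \<in> N" "\<pi> (h (Face f)) = h (Face g)"
      unfolding aut_faces_eq[OF \<pi>] unfolding XC_sel by blast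
    have "\<sigma> x \<in> corners g" if "x \<in> corners f" for x
    proof -
      have x: "x \<in> V" using corners_subset[OF f(1)] that by blast
      have "h (Face f) \<in> points XC" using f by (auto simp: points_XC)
      then have "inc XC (\<pi> (h (Vert x))) (\<pi> (h (Face f)))"
        using aut_inc_iff[OF \<pi> vert_point(1)[OF x]] f that by simp
      then show ?thesis by (simp add: g \<sigma>(2)[OF x])
    qed
    then show ?thesis using f g by (auto simp: around_def)
  qed
  have outer: "\<sigma> Outer = Outer"
    using deg[of Outer] n_gt_2 by (cases "\<sigma> Outer") (simp_all add: length_ring del: ring.simps)
  have types: "\<sigma> v \<noteq> Inner" "\<sigma> v \<noteq> Outer" if "around Outer v w" "v \<noteq> Outer" "v \<in> V" for v w
    using around[OF that(1)] around_outer_unique(4) \<sigma>_eq[of v Outer] that outer by auto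
  have tri: "\<exists>j \<in> I. \<sigma> (Tri i) = Tri j" if "i \<in> I" for i
    using deg[of "Tri i"] types[OF around_outer(1)[OF that]] \<sigma>(1)[of "Tri i"] that
    by (cases "\<sigma> (Tri i)") (simp_all add: length_ring del: ring.simps)
  have quad: "\<exists>j \<in> I. \<sigma> (Quad i) = Quad j" if "i \<in> I" for i
    using deg[of "Quad i"] types[OF around_outer(2)[OF that]] \<sigma>(1)[of "Quad i"] that
    by (cases "\<sigma> (Quad i)") (simp_all add: length_ring del: ring.simps)
  have hept: "\<exists>j \<in> I. \<sigma> (Hept i) = Hept j" if "i \<in> I" for i
    using deg[of "Hept i"] types[OF around_outer(3)[OF that]] \<sigma>(1)[of "Hept i"] that
    by (cases "\<sigma> (Hept i)") (simp_all add: length_ring del: ring.simps)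
  have cell: "\<sigma> (Quad i) = Quad j \<and> \<sigma> (Hept (nx i)) = Hept (nx j) \<and> \<sigma> (Tri (nx i)) = Tri (nx j)"
    if i: "i \<in> I" and j: "\<sigma> (Tri i) = Tri j" for i j
  proof -
    obtain a b c where abc: "\<sigma> (Quad i) = Quad a" "\<sigma> (Hept (nx i)) = Hept b" "\<sigma> (Tri (nx i)) = Tri c"
      using quad[OF i] hept[OF shift_mem] tri[OF shift_mem] by blast
    have "a = j" "b = nx a" "c = b"
      using around[OF around_outer(1)[OF i]] around[OF around_outer(2)[OF i]]
        around[OF around_outer(3)[OF shift_mem[of 1 i]]] around_outer_unique
      unfolding abc j outer by blast+
    then show ?thesis using abc by simp
  qed
  have one: "1 \<in> I" using n_gt_2 by simp
  obtain m where m: "m \<in> I" "\<sigma> (Tri 1) = Tri m" using tri[OF one] by blast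
  \<comment> \<open>The rotation that moves cell \<open>1\<close> to cell \<open>m\<close>.\<close>
  define k where "k = int m - 1"
  have m': "shift k 1 = m" using m(1) by (auto simp: shift_def k_def)
  have tri_k: "Suc i \<le> n \<longrightarrow> \<sigma> (Tri (Suc i)) = Tri (shift k (Suc i))" for i
  proof (induction i)
    case (Suc i)
    show ?case
    proof
      assume i: "Suc (Suc i) \<le> n"
      then have "Suc i \<in> I" "nx (Suc i) = Suc (Suc i)" by (auto simp: nx_eq)
      then show "\<sigma> (Tri (Suc (Suc i))) = Tri (shift k (Suc (Suc i)))"
        using cell[of "Suc i"] Suc.IH i shift_nx[of k "Suc i"] by simp
    qed
  qed (use m m' in simp)
  have tri_k: "\<sigma> (Tri i) = Tri (shift k i)" if "i \<in> I" for i
    using tri_k[of "i - 1"] that by simp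
  have quad_k: "\<sigma> (Quad i) = Quad (shift k i)" if "i \<in> I" for i
    using cell[OF that tri_k[OF that]] by simp
  have hept_k: "\<sigma> (Hept i) = Hept (shift k i)" if "i \<in> I" for i
    using cell[OF shift_mem tri_k[OF shift_mem], of "-1" i] that
    by (simp add: shift_nx[symmetric])
  have ring_k: "\<sigma> v = turn_vert k v" if "v \<in> V" "v \<noteq> Inner" for v
    using that outer tri_k quad_k hept_k by (cases v) auto
  have "\<sigma> v = turn_vert k v" if v: "v \<in> V" for v
  proof (cases "v = Inner")
    case True
    \<comment> \<open>All other values are already taken.\<close>
    have "\<sigma> Inner = Inner"
    proof (rule ccontr)
      assume neq: "\<sigma> Inner \<noteq> Inner"
      define u where "u = turn_vert (-k) (\<sigma> Inner)"
      have u: "u \<in> V" using \<sigma>(1) v True by (simp add: u_def turn_vert_mem)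
      have "u \<noteq> Inner" using neq by (cases "\<sigma> Inner") (auto simp: u_def)
      moreover have "turn_vert k u = \<sigma> Inner"
        using \<sigma>(1) v True by (simp add: u_def turn_vert_turn_vert turn_vert_0)
      ultimately have "\<sigma> u = \<sigma> Inner" using ring_k u by simp
      then show False using \<sigma>_eq[OF u] \<open>u \<noteq> Inner\<close> by simp
    qed
    then show ?thesis using True by simp
  qed (use ring_k v in simp)
  then have "\<pi> (h (Vert v)) = rot k (h (Vert v))" if "v \<in> V" for v
    using that \<sigma>(2) rot_h[of "Vert v" k] by simp
  then have "\<pi> = rot k"
    by (intro aut_eqI[OF XC_vertex_faithful \<pi> rot_aut]) (auto simp: XC_sel)
  then show ?thesis ..
qed

lemma aut_group_XC: "aut_group XC \<cong> integer_mod_group n"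
proof -
  have carrier: "carrier (integer_mod_group n) = {0..<int n}"
    using n_gt_2 by (simp add: carrier_integer_mod_group)
  have "rot \<in> iso (integer_mod_group n) (aut_group XC)"
  proof (rule isoI)
    show "rot \<in> hom (integer_mod_group n) (aut_group XC)"
    proof (rule homI)
      show "rot a \<in> carrier (aut_group XC)" for a
        by (simp add: aut_group_def rot_aut)
      fix a b
      have "rot a \<in> Bij (points XC)" "rot b \<in> Bij (points XC)"
        using rot_aut by (auto simp: surface_auts_def)
      moreover have "rot ((a + b) mod int n) = rot (a + b)"
        by (simp add: rot_eq_iff)
      ultimately show "rot (a \<otimes>\<^bsub>integer_mod_group n\<^esub> b) = rot a \<otimes>\<^bsub>aut_group XC\<^esub> rot b"
        by (simp add: aut_group_def BijGroup_def rot_compose)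
    qed
    show "bij_betw rot (carrier (integer_mod_group n)) (carrier (aut_group XC))"
      unfolding bij_betw_def
    proof
      show "inj_on rot (carrier (integer_mod_group n))"
        by (auto simp: carrier rot_eq_iff inj_on_def)
      have "\<exists>a \<in> {0..<int n}. \<pi> = rot a" if "\<pi> \<in> surface_auts XC" for \<pi>
      proof -
        obtain k where "\<pi> = rot k" using aut_is_rot \<open>\<pi> \<in> surface_auts XC\<close> by blast
        then have "\<pi> = rot (k mod int n)" by (simp add: rot_eq_iff)
        then show ?thesis using n_gt_2 by (intro bexI[of _ "k mod int n"]) auto
      qed
      then show "rot ` carrier (integer_mod_group n) = carrier (aut_group XC)"
        using rot_aut by (auto simp: carrier aut_group_def)
    qed
  qed
  then have "integer_mod_group n \<cong> aut_group XC" by (auto simp: is_iso_def)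
  then show ?thesis by (rule group.iso_sym[OF group_integer_mod_group])
qed

end

section \<open>The theorem\<close>

theorem theorem7p3:
  fixes n :: nat
  assumes "n > 2"
  shows "(\<exists>X :: nat surface.
            simplicial_sphere X \<and> vertex_faithful X \<and>
            graph_iso (face_graph X) (gamma n) \<and>
            aut_group X \<cong> integer_mod_group n) \<and>
         k_connected 3 (gamma n) \<and> planar (gamma n) \<and> cubic (gamma n)"
proof -
  interpret gamma_surface n "to_nat :: point \<Rightarrow> nat"
    by unfold_locales (use assms in simp_all)
  show ?thesis
    using XC_sphere XC_vertex_faithful XC_face_graph aut_group_XC
      gamma_3_connected gamma_planar gamma_cubic by blast
qed

end
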